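(* Let $I=(a_-,a_+)\subset\mathbb{R}$ be a bounded open interval, $p\in[1,\infty)$, $w\in L^1(I)$ a stable weight, $m\ge1$ an integer, $\bar k\in\{0,\dots,m-1\}$ and $\Delta k:=m-\bar k$. If $a_-\notin\bar I_{cr}^{\,\Delta k-1,p}(w)$, then for each $k\in\{0,\dots,\bar k\}$ the trace operator $$(\mathrm{Tr}^k\,\cdot\,)(a_-):\mathcal{D}(\mathbb{R})\to\mathbb{R},\qquad \mathrm{Tr}^ku\,(a_-):=D^ku(a_-),$$ has a continuous extension to $H^{m,p}_{\mu_w}$. The same independently applies to the operator $(\mathrm{Tr}^k\,\cdot\,)(a_+)$, $\mathrm{Tr}^ku\,(a_+):=D^ku(a_+)$, provided $a_+\notin\bar I_{cr}^{\,\Delta k-1,p}(w)$.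
   Context: A weight is a non-negative function $w\in L^1(I)$. $\mathcal{L}^1$ is Lebesgue measure, $\mu_w:=w\,\mathcal{L}^1$ restricted to $I$, and $L^p_{\mu_w}$ is the Lebesgue space with norm $(\int_I w|u|^p\,dx)^{1/p}$. $p'=p/(p-1)$ is the Hölder conjugate ($p'=\infty$ if $p=1$). Convention: $\alpha/0=0$ if $\alpha=0$ and $\alpha/0=\infty$ if $\alpha>0$. $\mathcal{D}(\mathbb{R})$ denotes smooth compactly supported functions on $\mathbb{R}$ (they need not vanish at $a_\pm$). Critical set of order $\alpha\in[0,\infty)$: for $p\in(1,\infty)$, $$\bar I_{cr}^{\,\alpha,p}(w):=\Big\{x_0\in\bar I:\ \forall\varepsilon>0\ \int_{\bar I\cap B(x_0,\varepsilon)}\Big(\frac{|x-x_0|^\alpha}{(w(x))^{1/p}}\Big)^{p'}dx=\infty\Big\},$$ and for $p=1$, $\bar I_{cr}^{\,\alpha,1}(w):=\{x_0\in\bar I:\ \forall\varepsilon>0\ \ \mathcal{L}^1\text{-}\mathrm{ess\,sup}\{|x-x_0|^\alpha/w(x): x\in\bar I\cap B(x_0,\varepsilon)\}=\infty\}$. The right-sided and left-sided critical sets $\bar I_{cr,+}^{\,\alpha,p}(w)$ and $\bar I_{cr,-}^{\,\alpha,p}(w)$ are defined in the same way with $B(x_0,\varepsilon)$ replaced by $B_+(x_0,\varepsilon):=(x_0,x_0+\varepsilon)$ and $B_-(x_0,\varepsilon):=(x_0-\varepsilon,x_0)$, respectively. Stability (for the given $p$): a point $x_0\in\bar I_{cr,+}^{\,0,p}(w)$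 (resp. $x_0\in\bar I_{cr,-}^{\,0,p}(w)$) is right-sided (resp. left-sided) stable if there is $r>0$ such that $w$ has an a.e. equal representative which, on $B_+(x_0,r)\cap I$ (resp. $B_-(x_0,r)\cap I$), does not decrease with the distance $|x-x_0|$. A critical point $x_0\in\bar I_{cr}^{\,0,p}(w)$ is stable if it is right-sided stable or left-sided stable. The weight $w$ is stable if every $x_0\in\bar I_{cr}^{\,0,p}(w)$ is stable. Stable weights satisfy $\mu_w(\bar I_{cr}^{\,0,p}(w))=0$, which makes the following definition meaningful. For an integer $m\ge1$ let $H^{m,p}_{\mu_w}$ be the set of $u\in L^p_{\mu_w}$ for which there exist $u_h\in\mathcal{D}(\mathbb{R})$ and $v_1,\dots,v_m\in L^p_{\mu_w}$ with $u_h\to u$ and $D^ku_h\to v_k$ in $L^p_{\mu_w}$, $k=1,\dots,m$ (classical derivatives). The $v_k$ are uniquely determined by $u$ and are denoted $D^k_{\mu_w}u$, with $D^0_{\mu_w}u:=u$. The norm is $\|u\|_{H^{m,p}_{\mu_w}}=(\sum_{k=0}^m\|D^k_{\mu_w}u\|^p_{L^p_{\mu_w}})^{1/p}$. *)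

theory Defs
  imports "HOL-Analysis.Analysis" "HOL-Probability.Essential_Supremum"
begin

text \<open>
  Throughout, \<open>I = {a<..<b}\<close>. Elements of Lebesgue spaces on \<open>I\<close> are represented by functions
  \<open>real \<Rightarrow> real\<close>; their values outside \<open>I\<close> are irrelevant, and equality of elements is almost
  everywhere equality on \<open>I\<close>.
\<close>

definition weight :: "real \<Rightarrow> real \<Rightarrow> (real \<Rightarrow> real) \<Rightarrow> bool" where
  "weight a b w \<longleftrightarrow>
     integrable (lebesgue_on {a<..<b}) w \<and> (AE x in lebesgue_on {a<..<b}. 0 \<le> w x)"

definition weight_measure :: "real \<Rightarrow> real \<Rightarrow> (real \<Rightarrow> real) \<Rightarrow> real measure" where
  "weight_measure a b w = density (lebesgue_on {a<..<b}) (\<lambda>x. ennreal (w x))"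

subsection \<open>Critical sets and stability\<close>

text \<open>Meant for exponents \<open>s > 0\<close>.\<close>

definition ennreal_powr :: "ennreal \<Rightarrow> real \<Rightarrow> ennreal" where
  "ennreal_powr x s = (if x = \<infinity> then \<infinity> else ennreal (enn2real x powr s))"

text \<open>
  Division on \<open>ennreal\<close> obeys the convention \<open>0 / 0 = 0\<close> and \<open>c / 0 = \<infinity>\<close> for \<open>c > 0\<close>.
  The possibly unspecified values of \<open>w\<close> at \<open>a\<close> and \<open>b\<close>, and the value \<open>0 powr 0 = 0\<close> at
  \<open>x = x0\<close>, only concern null sets.
\<close>

definition crit_size ::
  "real \<Rightarrow> real \<Rightarrow> real \<Rightarrow> (real \<Rightarrow> real) \<Rightarrow> real \<Rightarrow> real \<Rightarrow> real set \<Rightarrow> ennreal" where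
  "crit_size a b p w \<alpha> x0 B =
     (if p = 1
      then esssup (lebesgue_on ({a..b} \<inter> B))
             (\<lambda>x. ennreal (\<bar>x - x0\<bar> powr \<alpha>) / ennreal (w x))
      else \<integral>\<^sup>+ x. ennreal_powr (ennreal (\<bar>x - x0\<bar> powr \<alpha>) / ennreal (w x powr (1 / p))) (p / (p - 1))
             \<partial>lebesgue_on ({a..b} \<inter> B))"

text \<open>The argument \<open>nb x0 \<epsilon>\<close> is the full, right or left neighbourhood of \<open>x0\<close> of radius \<open>\<epsilon>\<close>.\<close>

definition crit_set_wrt ::
  "(real \<Rightarrow> real \<Rightarrow> real set) \<Rightarrow> real \<Rightarrow> real \<Rightarrow> real \<Rightarrow> (real \<Rightarrow> real) \<Rightarrow> real \<Rightarrow> real set" where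
  "crit_set_wrt nb a b p w \<alpha> =
     {x0 \<in> {a..b}. \<forall>\<epsilon>>0. crit_size a b p w \<alpha> x0 (nb x0 \<epsilon>) = \<infinity>}"

definition right_nb :: "real \<Rightarrow> real \<Rightarrow> real set" where
  "right_nb x0 \<epsilon> = {x0<..<x0 + \<epsilon>}"

definition left_nb :: "real \<Rightarrow> real \<Rightarrow> real set" where
  "left_nb x0 \<epsilon> = {x0 - \<epsilon><..<x0}"

definition crit_set :: "real \<Rightarrow> real \<Rightarrow> real \<Rightarrow> (real \<Rightarrow> real) \<Rightarrow> real \<Rightarrow> real set" where
  "crit_set = crit_set_wrt ball"

definition one_sided_stable ::
  "(real \<Rightarrow> real \<Rightarrow> real set) \<Rightarrow> real \<Rightarrow> real \<Rightarrow> real \<Rightarrow> (real \<Rightarrow> real) \<Rightarrow> real \<Rightarrow> bool" where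
  "one_sided_stable nb a b p w x0 \<longleftrightarrow>
     x0 \<in> crit_set_wrt nb a b p w 0 \<and>
     (\<exists>r>0. \<exists>v. (AE x in lebesgue_on {a<..<b}. v x = w x) \<and>
        (\<forall>x \<in> nb x0 r \<inter> {a<..<b}. \<forall>y \<in> nb x0 r \<inter> {a<..<b}.
           \<bar>x - x0\<bar> \<le> \<bar>y - x0\<bar> \<longrightarrow> v x \<le> v y))"

definition stable_weight :: "real \<Rightarrow> real \<Rightarrow> real \<Rightarrow> (real \<Rightarrow> real) \<Rightarrow> bool" where
  "stable_weight a b p w \<longleftrightarrow>
     weight a b w \<and>
     (\<forall>x0 \<in> crit_set a b p w 0.
        one_sided_stable right_nb a b p w x0 \<or> one_sided_stable left_nb a b p w x0)"

subsection \<open>Weighted Sobolev spaces\<close>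

definition test_functions :: "(real \<Rightarrow> real) set" where
  "test_functions =
     {u. (\<forall>n. (deriv ^^ n) u differentiable_on UNIV) \<and> compact (closure {x. u x \<noteq> 0})}"

definition Lp :: "real measure \<Rightarrow> real \<Rightarrow> (real \<Rightarrow> real) set" where
  "Lp M p = {u \<in> borel_measurable M. integrable M (\<lambda>x. \<bar>u x\<bar> powr p)}"

definition Lp_norm :: "real measure \<Rightarrow> real \<Rightarrow> (real \<Rightarrow> real) \<Rightarrow> real" where
  "Lp_norm M p u = (\<integral>x. \<bar>u x\<bar> powr p \<partial>M) powr (1 / p)"

definition Lp_tendsto ::
  "real measure \<Rightarrow> real \<Rightarrow> (nat \<Rightarrow> real \<Rightarrow> real) \<Rightarrow> (real \<Rightarrow> real) \<Rightarrow> bool" where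
  "Lp_tendsto M p f g \<longleftrightarrow>
     (\<forall>h. f h \<in> Lp M p) \<and> g \<in> Lp M p \<and> (\<lambda>h. Lp_norm M p (\<lambda>x. f h x - g x)) \<longlonglongrightarrow> 0"

definition sobolev_derivs ::
  "real \<Rightarrow> real \<Rightarrow> real \<Rightarrow> (real \<Rightarrow> real) \<Rightarrow> nat \<Rightarrow> (real \<Rightarrow> real) \<Rightarrow> (nat \<Rightarrow> real \<Rightarrow> real) \<Rightarrow> bool" where
  "sobolev_derivs a b p w m u v \<longleftrightarrow>
     (\<exists>uh. (\<forall>h. uh h \<in> test_functions) \<and>
        Lp_tendsto (weight_measure a b w) p uh u \<and>
        (\<forall>k\<in>{1..m}. Lp_tendsto (weight_measure a b w) p (\<lambda>h. (deriv ^^ k) (uh h)) (v k)))"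

definition sobolev :: "real \<Rightarrow> real \<Rightarrow> real \<Rightarrow> (real \<Rightarrow> real) \<Rightarrow> nat \<Rightarrow> (real \<Rightarrow> real) set" where
  "sobolev a b p w m =
     {u \<in> Lp (weight_measure a b w) p. \<exists>v. sobolev_derivs a b p w m u v}"

text \<open>
  For a stable weight the derivatives are unique up to null sets of the weight measure, so the
  choice below only selects a representative.
\<close>

definition sobolev_D ::
  "real \<Rightarrow> real \<Rightarrow> real \<Rightarrow> (real \<Rightarrow> real) \<Rightarrow> nat \<Rightarrow> nat \<Rightarrow> (real \<Rightarrow> real) \<Rightarrow> real \<Rightarrow> real" where
  "sobolev_D a b p w m k u = (if k = 0 then u else (SOME v. sobolev_derivs a b p w m u v) k)"

definition sobolev_norm ::
  "real \<Rightarrow> real \<Rightarrow> real \<Rightarrow> (real \<Rightarrow> real) \<Rightarrow> nat \<Rightarrow> (real \<Rightarrow> real) \<Rightarrow> real" where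
  "sobolev_norm a b p w m u =
     (\<Sum>k\<le>m. Lp_norm (weight_measure a b w) p (sobolev_D a b p w m k u) powr p) powr (1 / p)"

text \<open>
  An extension is required to be an operator on the space of equivalence classes (first conjunct),
  linear, and continuous with respect to the Sobolev norm.
\<close>

definition has_continuous_extension ::
  "real \<Rightarrow> real \<Rightarrow> real \<Rightarrow> (real \<Rightarrow> real) \<Rightarrow> nat \<Rightarrow> ((real \<Rightarrow> real) \<Rightarrow> real) \<Rightarrow> bool" where
  "has_continuous_extension a b p w m T \<longleftrightarrow>
     (\<exists>E :: (real \<Rightarrow> real) \<Rightarrow> real.
        (\<forall>u \<in> sobolev a b p w m. \<forall>v \<in> sobolev a b p w m.
           (AE x in weight_measure a b w. u x = v x) \<longrightarrow> E u = E v) \<and>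
        (\<forall>u \<in> sobolev a b p w m. \<forall>v \<in> sobolev a b p w m. \<forall>c d.
           E (\<lambda>x. c * u x + d * v x) = c * E u + d * E v) \<and>
        (\<forall>u \<in> sobolev a b p w m. \<forall>\<epsilon>>0. \<exists>\<delta>>0. \<forall>v \<in> sobolev a b p w m.
           sobolev_norm a b p w m (\<lambda>x. v x - u x) < \<delta> \<longrightarrow> \<bar>E v - E u\<bar> < \<epsilon>) \<and>
        (\<forall>u \<in> test_functions. E u = T u))"

end

theory Submission
  imports Defs
begin

text \<open>
  The trace exists because a derivative at the end point is controlled by the derivatives at an
  interior point plus a Taylor remainder, and the critical set is defined exactly so that this
  remainder is controlled by the weighted norm. Let \<open>x\<^sub>0\<close> be an end point, \<open>n = m - k\<close>, and let \<open>f\<close> be the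
  \<open>k\<close>-th derivative of a test function. Taylor's formula at \<open>x\<close> bounds \<open>\<bar>f x\<^sub>0\<bar>\<close> by the values of
  the first \<open>n\<close> derivatives of \<open>f\<close> (orders \<open>0\<close> to \<open>n - 1\<close>) at \<open>x\<close> and the integral of
  \<open>\<bar>x\<^sub>0 - t\<bar> ^ (n - 1) * \<bar>f\<^sup>(\<^sup>n\<^sup>) t\<bar>\<close> between \<open>x\<close> and \<open>x\<^sub>0\<close>. If \<open>x\<^sub>0\<close> is not critical of order \<open>\<alpha> \<le> n - 1\<close>,
  Hoelder's inequality gives, on a neighbourhood of \<open>x\<^sub>0\<close>, the bound
  \<open>\<integral> \<bar>x\<^sub>0 - t\<bar> powr \<alpha> * \<bar>g t\<bar> dt \<le> C \<parallel>g\<parallel>\<close> for every \<open>g\<close> in the weighted space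
  (\<open>L1_controlled_noncritical\<close>). It bounds the remainder, and on a compact interval away from \<open>x\<^sub>0\<close>, where
  the factor \<open>\<bar>x\<^sub>0 - t\<bar> powr \<alpha>\<close> is bounded below, it bounds the averages of the lower order derivatives; \<open>x\<close> is
  then chosen where the sum of their absolute values is at most its average. The result is \<open>trace_bound\<close>.

  The extension maps \<open>u\<close> to the limit of the traces of test functions that approximate \<open>u\<close> together
  with its derivatives. By the trace estimate these limits exist and are bounded by the norms of the limit
  functions; they depend on \<open>u\<close> alone provided that the derivatives of \<open>u\<close> do. This
  uniqueness (\<open>derivative_limit_zero\<close>) is where stability enters. Near a non-critical point the
  weighted space embeds into \<open>L\<^sup>1\<close>, so derivatives are distributional derivatives there and hence
  unique. On the stable side of a critical point the weight is monotone, so that each nearby point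
  on that side has, to its left or right, an interval on which the weight vanishes, which is invisible to the weighted
  measure, or on which the weight is bounded below, where the embedding holds again. Uniqueness on a
  one-sided neighbourhood of every point is enough, because open one-sided neighbourhoods cover all
  but countably many points (\<open>negligible_one_sided_cover\<close>).
\<close>

section \<open>Lebesgue spaces as quasi-normed spaces\<close>

lemma abs_add_powr_le:
  fixes x y p :: real
  assumes "0 \<le> p"
  shows "\<bar>x + y\<bar> powr p \<le> 2 powr p * (\<bar>x\<bar> powr p + \<bar>y\<bar> powr p)"
proof -
  have "\<bar>x + y\<bar> powr p \<le> (2 * max \<bar>x\<bar> \<bar>y\<bar>) powr p"
    by (intro powr_mono2 assms) auto
  also have "\<dots> = 2 powr p * max \<bar>x\<bar> \<bar>y\<bar> powr p"
    by (simp add: powr_mult)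
  also have "max \<bar>x\<bar> \<bar>y\<bar> powr p \<le> \<bar>x\<bar> powr p + \<bar>y\<bar> powr p"
    by (simp add: max_def)
  finally show ?thesis by simp
qed

lemma Lp_scale:
  assumes "u \<in> Lp M p"
  shows "(\<lambda>x. c * u x) \<in> Lp M p"
  using assms by (auto simp: Lp_def abs_mult powr_mult)

lemma Lp_norm_scale:
  assumes "0 < p"
  shows "Lp_norm M p (\<lambda>x. c * u x) = \<bar>c\<bar> * Lp_norm M p u"
  using assms
  by (simp add: Lp_norm_def abs_mult powr_mult powr_powr)

lemma Lp_add:
  assumes "0 \<le> p" "u \<in> Lp M p" "v \<in> Lp M p"
  shows "(\<lambda>x. u x + v x) \<in> Lp M p"
proof -
  have [measurable]: "u \<in> borel_measurable M" "v \<in> borel_measurable M"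
    using assms by (auto simp: Lp_def)
  have "integrable M (\<lambda>x. 2 powr p * (\<bar>u x\<bar> powr p + \<bar>v x\<bar> powr p))"
    using assms by (auto simp: Lp_def)
  then have "integrable M (\<lambda>x. \<bar>u x + v x\<bar> powr p)"
    by (rule Bochner_Integration.integrable_bound) (auto simp: abs_add_powr_le[OF assms(1)])
  then show ?thesis
    by (simp add: Lp_def)
qed

text \<open>
  The quasi-triangle inequality replaces Minkowski's: every estimate below only has to hold up to a
  constant factor. The constant \<open>4\<close> is one factor \<open>2\<close> from \<open>\<bar>x + y\<bar> \<le> 2 * max \<bar>x\<bar> \<bar>y\<bar>\<close>, times a bound for
  \<open>2 powr (1 / p)\<close>.
\<close>
lemma Lp_norm_add_le:
  assumes "1 \<le> p" "u \<in> Lp M p" "v \<in> Lp M p"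
  shows "Lp_norm M p (\<lambda>x. u x + v x) \<le> 4 * (Lp_norm M p u + Lp_norm M p v)"
proof -
  define A B where "A = (\<integral>x. \<bar>u x\<bar> powr p \<partial>M)" and "B = (\<integral>x. \<bar>v x\<bar> powr p \<partial>M)"
  have [simp]: "0 \<le> A" "0 \<le> B"
    by (auto simp: A_def B_def)
  have "(\<integral>x. \<bar>u x + v x\<bar> powr p \<partial>M) \<le> (\<integral>x. 2 powr p * (\<bar>u x\<bar> powr p + \<bar>v x\<bar> powr p) \<partial>M)"
    using assms Lp_add[of p u M v]
    by (intro integral_mono) (auto simp: Lp_def abs_add_powr_le)
  also have "\<dots> = 2 powr p * (A + B)"
    using assms by (simp add: A_def B_def Lp_def)
  also have "\<dots> \<le> 2 powr p * (2 * max A B)"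
    by (intro mult_left_mono) auto
  finally have "Lp_norm M p (\<lambda>x. u x + v x) \<le> (2 powr p * (2 * max A B)) powr (1 / p)"
    unfolding Lp_norm_def using assms(1) by (intro powr_mono2) auto
  also have "\<dots> = 2 * (2 powr (1 / p)) * max A B powr (1 / p)"
    using assms(1) by (simp add: powr_mult powr_powr)
  also have "\<dots> \<le> 4 * max A B powr (1 / p)"
    using assms(1) powr_mono[of "1 / p" 1 "2::real"]
    by (intro mult_right_mono) auto
  also have "\<dots> \<le> 4 * (A powr (1 / p) + B powr (1 / p))"
    by (auto simp: max_def)
  finally show ?thesis
    by (simp add: Lp_norm_def A_def B_def)
qed

lemma Lp_lincomb:
  assumes "0 \<le> p" "u \<in> Lp M p" "v \<in> Lp M p"
  shows "(\<lambda>x. c * u x + d * v x) \<in> Lp M p"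
  using assms by (intro Lp_add Lp_scale)

lemma Lp_diff:
  assumes "0 \<le> p" "u \<in> Lp M p" "v \<in> Lp M p"
  shows "(\<lambda>x. u x - v x) \<in> Lp M p"
  using Lp_lincomb[OF assms, of 1 "-1"] by simp

lemma Lp_norm_lincomb_le:
  assumes "1 \<le> p" "u \<in> Lp M p" "v \<in> Lp M p"
  shows "Lp_norm M p (\<lambda>x. c * u x + d * v x) \<le> 4 * (\<bar>c\<bar> * Lp_norm M p u + \<bar>d\<bar> * Lp_norm M p v)"
  using Lp_norm_add_le[OF assms(1) Lp_scale[OF assms(2)] Lp_scale[OF assms(3)], of c d] assms(1)
  by (simp add: Lp_norm_scale)

lemma Lp_norm_nonneg [simp]: "0 \<le> Lp_norm M p u"
  by (simp add: Lp_norm_def)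

lemma Lp_tendsto_lincomb:
  assumes p: "1 \<le> p" and f: "Lp_tendsto M p f u" and g: "Lp_tendsto M p g v"
  shows "Lp_tendsto M p (\<lambda>h x. c * f h x + d * g h x) (\<lambda>x. c * u x + d * v x)"
  unfolding Lp_tendsto_def
proof (intro conjI allI)
  have fL: "f h \<in> Lp M p" "u \<in> Lp M p" and gL: "g h \<in> Lp M p" "v \<in> Lp M p" for h
    using f g by (auto simp: Lp_tendsto_def)
  show "(\<lambda>x. c * f h x + d * g h x) \<in> Lp M p" for h
    using p by (intro Lp_lincomb fL gL) auto
  show "(\<lambda>x. c * u x + d * v x) \<in> Lp M p"
    using p by (intro Lp_lincomb fL gL) auto
  let ?e = "\<lambda>h. 4 * (\<bar>c\<bar> * Lp_norm M p (\<lambda>x. f h x - u x) + \<bar>d\<bar> * Lp_norm M p (\<lambda>x. g h x - v x))"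
  have lim: "?e \<longlonglongrightarrow> 4 * (\<bar>c\<bar> * 0 + \<bar>d\<bar> * 0)"
    using f g by (intro tendsto_intros) (auto simp: Lp_tendsto_def)
  have le: "Lp_norm M p (\<lambda>x. c * f h x + d * g h x - (c * u x + d * v x)) \<le> ?e h" for h
  proof -
    have eq: "(\<lambda>x. c * f h x + d * g h x - (c * u x + d * v x)) =
          (\<lambda>x. c * (f h x - u x) + d * (g h x - v x))"
      by (auto simp: algebra_simps)
    show ?thesis
      unfolding eq using p by (intro Lp_norm_lincomb_le Lp_diff fL gL) auto
  qed
  show "(\<lambda>h. Lp_norm M p (\<lambda>x. c * f h x + d * g h x - (c * u x + d * v x))) \<longlonglongrightarrow> 0"
    by (rule tendsto_sandwich[OF _ _ tendsto_const]) (use lim le in \<open>auto intro!: always_eventually\<close>)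
qed

lemma Lp_norm_cong_AE:
  assumes "AE x in M. u x = v x" "u \<in> borel_measurable M" "v \<in> borel_measurable M"
  shows "Lp_norm M p u = Lp_norm M p v"
proof -
  have "(\<integral>x. \<bar>u x\<bar> powr p \<partial>M) = (\<integral>x. \<bar>v x\<bar> powr p \<partial>M)"
    using assms by (intro integral_cong_AE) auto
  then show ?thesis by (simp add: Lp_norm_def)
qed

lemma Lp_tendsto_cong_AE:
  assumes "Lp_tendsto M p f u" "AE x in M. u x = v x" "v \<in> Lp M p"
  shows "Lp_tendsto M p f v"
proof -
  have "Lp_norm M p (\<lambda>x. f h x - v x) = Lp_norm M p (\<lambda>x. f h x - u x)" for h
    using assms by (intro Lp_norm_cong_AE borel_measurable_diff) (auto simp: Lp_tendsto_def Lp_def)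
  then show ?thesis
    using assms by (auto simp: Lp_tendsto_def)
qed

lemma Lp_tendsto_const: "u \<in> Lp M p \<Longrightarrow> Lp_tendsto M p (\<lambda>_. u) u"
  by (simp add: Lp_tendsto_def Lp_norm_def)

section \<open>Weighted integrals controlled by the norm of the weighted Lebesgue space\<close>

lemma measurable_weight_measure [simp]:
  "borel_measurable (weight_measure a b w) = borel_measurable (lebesgue_on {a<..<b})"
  by (auto simp: weight_measure_def measurable_def)

lemma weight_borel_measurable:
  "weight a b w \<Longrightarrow> w \<in> borel_measurable (lebesgue_on {a<..<b})"
  by (auto simp: weight_def)

lemma AE_weight_measure_iff:
  assumes "weight a b w"
  shows "(AE x in weight_measure a b w. P x) \<longleftrightarrow> (AE x in lebesgue_on {a<..<b}. 0 < w x \<longrightarrow> P x)"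
  using weight_borel_measurable[OF assms] unfolding weight_measure_def
  by (subst AE_density) auto

text \<open>
  \<open>\<phi>\<close> acts as a bounded functional \<open>g \<mapsto> \<integral> \<phi> \<bar>g\<bar>\<close> on the weighted space: for \<open>p > 1\<close> and \<open>\<phi> \<ge> 0\<close> this
  says that \<open>\<phi> / w powr (1 / p)\<close> lies in \<open>L\<close> with the conjugate exponent. Stating the consequence
  instead of the condition treats \<open>p = 1\<close> and \<open>p > 1\<close> alike. The integral is a nonnegative one because
  the integrability of \<open>\<phi> \<bar>g\<bar>\<close> is part of the claim.
\<close>
definition L1_controlled :: "real \<Rightarrow> real \<Rightarrow> real \<Rightarrow> (real \<Rightarrow> real) \<Rightarrow> (real \<Rightarrow> real) \<Rightarrow> bool" where
  "L1_controlled a b p w \<phi> \<longleftrightarrow>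
     \<phi> \<in> borel_measurable (lebesgue_on {a<..<b}) \<and>
     (\<exists>C\<ge>0. \<forall>g \<in> Lp (weight_measure a b w) p.
        (\<integral>\<^sup>+x. ennreal (\<phi> x * \<bar>g x\<bar>) \<partial>lebesgue_on {a<..<b})
          \<le> ennreal (C * Lp_norm (weight_measure a b w) p g))"

lemma nn_integral_weighted_powr:
  assumes w: "weight a b w" and p: "0 < p" and g: "g \<in> Lp (weight_measure a b w) p"
  shows "(\<integral>\<^sup>+x. ennreal (w x * \<bar>g x\<bar> powr p) \<partial>lebesgue_on {a<..<b}) =
         ennreal (Lp_norm (weight_measure a b w) p g powr p)"
proof -
  have [measurable]: "g \<in> borel_measurable (lebesgue_on {a<..<b})"
      "w \<in> borel_measurable (lebesgue_on {a<..<b})"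
    using g w by (auto simp: Lp_def weight_def)
  have "(\<integral>\<^sup>+x. ennreal (w x * \<bar>g x\<bar> powr p) \<partial>lebesgue_on {a<..<b}) =
      (\<integral>\<^sup>+x. ennreal (w x) * ennreal (\<bar>g x\<bar> powr p) \<partial>lebesgue_on {a<..<b})"
    using w by (intro nn_integral_cong_AE) (auto simp: weight_def ennreal_mult elim!: eventually_mono)
  also have "\<dots> = (\<integral>\<^sup>+x. ennreal (\<bar>g x\<bar> powr p) \<partial>weight_measure a b w)"
    unfolding weight_measure_def by (subst nn_integral_density) auto
  also have "\<dots> = ennreal (\<integral>x. \<bar>g x\<bar> powr p \<partial>weight_measure a b w)"
    using g by (intro nn_integral_eq_integral) (auto simp: Lp_def)
  also have "(\<integral>x. \<bar>g x\<bar> powr p \<partial>weight_measure a b w) = Lp_norm (weight_measure a b w) p g powr p"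
    using p by (simp add: Lp_norm_def powr_powr)
  finally show ?thesis .
qed

text \<open>
  A pointwise inequality of Young type suffices: integrated, it bounds \<open>\<integral> \<phi> \<bar>g\<bar>\<close> by a constant on the
  unit ball of the weighted space, and the left-hand side is homogeneous in \<open>g\<close>.
\<close>
lemma L1_controlledI:
  assumes w: "weight a b w" and p: "1 \<le> p"
    and [measurable]: "\<phi> \<in> borel_measurable (lebesgue_on {a<..<b})"
      "\<kappa> \<in> borel_measurable (lebesgue_on {a<..<b})"
    and \<kappa>: "(\<integral>\<^sup>+x. \<kappa> x \<partial>lebesgue_on {a<..<b}) < \<infinity>" and K: "0 \<le> K"
    and pw: "AE x in lebesgue_on {a<..<b}. \<forall>s\<ge>0.
               ennreal (\<phi> x * s) \<le> ennreal (K * (w x * s powr p)) + \<kappa> x"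
  shows "L1_controlled a b p w \<phi>"
proof -
  let ?M = "lebesgue_on {a<..<b}" and ?N = "Lp_norm (weight_measure a b w) p"
  define C where "C = K + enn2real (\<integral>\<^sup>+x. \<kappa> x \<partial>?M)"
  have C0: "0 \<le> C"
    using K by (simp add: C_def)
  have wm [measurable]: "w \<in> borel_measurable ?M"
    by (rule weight_borel_measurable[OF w])
  have "(\<integral>\<^sup>+x. ennreal (\<phi> x * \<bar>g x\<bar>) \<partial>?M) \<le> ennreal (C * ?N g)"
    if g: "g \<in> Lp (weight_measure a b w) p" for g
  proof -
    have gm [measurable]: "g \<in> borel_measurable ?M"
      using g by (simp add: Lp_def)
    \<comment> \<open>Normalising by any \<open>t\<close> above the norm, not by the norm itself, covers functions of norm zero.\<close>
    have t: "(\<integral>\<^sup>+x. ennreal (\<phi> x * \<bar>g x\<bar>) \<partial>?M) \<le> ennreal (C * t)" if t: "?N g < t" for t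
    proof -
      have t0: "0 < t"
        using t Lp_norm_nonneg[of "weight_measure a b w" p g] by linarith
      have "(\<integral>\<^sup>+x. ennreal (\<phi> x * \<bar>g x\<bar>) \<partial>?M) =
          (\<integral>\<^sup>+x. ennreal t * ennreal (\<phi> x * (\<bar>g x\<bar> / t)) \<partial>?M)"
        using t0 by (intro nn_integral_cong) (simp add: ennreal_mult'[symmetric])
      also have "\<dots> = ennreal t * (\<integral>\<^sup>+x. ennreal (\<phi> x * (\<bar>g x\<bar> / t)) \<partial>?M)"
        by (intro nn_integral_cmult) measurable
      also have "(\<integral>\<^sup>+x. ennreal (\<phi> x * (\<bar>g x\<bar> / t)) \<partial>?M) \<le>
          (\<integral>\<^sup>+x. ennreal (K / t powr p) * ennreal (w x * \<bar>g x\<bar> powr p) + \<kappa> x \<partial>?M)"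
      proof (intro nn_integral_mono_AE)
        show "AE x in ?M. ennreal (\<phi> x * (\<bar>g x\<bar> / t)) \<le>
             ennreal (K / t powr p) * ennreal (w x * \<bar>g x\<bar> powr p) + \<kappa> x"
          using pw
        proof eventually_elim
          case (elim x)
          have "ennreal (\<phi> x * (\<bar>g x\<bar> / t)) \<le> ennreal (K * (w x * (\<bar>g x\<bar> / t) powr p)) + \<kappa> x"
            using elim[rule_format, of "\<bar>g x\<bar> / t"] t0 by simp
          also have "K * (w x * (\<bar>g x\<bar> / t) powr p) = K / t powr p * (w x * \<bar>g x\<bar> powr p)"
            using t0 by (simp add: powr_divide field_simps)
          finally show ?case
            using K ennreal_mult'[of "K / t powr p" "w x * \<bar>g x\<bar> powr p"] by simp
        qed
      qed
      also have "\<dots> = ennreal (K / t powr p) * ennreal (?N g powr p) + (\<integral>\<^sup>+x. \<kappa> x \<partial>?M)"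
        using nn_integral_weighted_powr[OF w _ g] p
        by (subst nn_integral_add) (auto simp: nn_integral_cmult)
      also have "\<dots> \<le> ennreal K + (\<integral>\<^sup>+x. \<kappa> x \<partial>?M)"
      proof -
        have "K / t powr p * ?N g powr p \<le> K / t powr p * t powr p"
          using t K p by (intro mult_left_mono powr_mono2) auto
        then have "K / t powr p * ?N g powr p \<le> K"
          using t0 by simp
        then show ?thesis
          using K by (intro add_right_mono) (simp add: ennreal_mult'[symmetric] ennreal_leI)
      qed
      also have "\<dots> = ennreal C"
        using \<kappa> K by (simp add: C_def ennreal_plus less_top)
      finally have "(\<integral>\<^sup>+x. ennreal (\<phi> x * \<bar>g x\<bar>) \<partial>?M) \<le> ennreal t * ennreal C"
        by (simp add: mult_left_mono)
      then show ?thesis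
        using t0 C0 by (simp add: ennreal_mult' mult.commute)
    qed
    have lim: "((\<lambda>t. ennreal (C * t)) \<longlongrightarrow> ennreal (C * ?N g)) (at_right (?N g))"
      by (intro tendsto_intros tendsto_ident_at)
    show ?thesis
      by (rule tendsto_lowerbound[OF lim]) (auto simp: eventually_at_filter t)
  qed
  then show ?thesis
    unfolding L1_controlled_def using C0 assms(3) by blast
qed

lemma ennreal_powr_measurable [measurable]:
  assumes [measurable]: "f \<in> borel_measurable M"
  shows "(\<lambda>x. ennreal_powr (f x) s) \<in> borel_measurable M"
  unfolding ennreal_powr_def by measurable

text \<open>
  Extended values make the inequality hold also where \<open>w\<close> vanishes: the quotient, and with it the
  right-hand side, is then infinite unless \<open>A = 0\<close>.
\<close>
lemma Young_ennreal_powr: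
  fixes A s w p :: real
  assumes "1 < p" "0 \<le> A" "0 \<le> s" "0 \<le> w"
  shows "ennreal (A * s) \<le>
           ennreal (w * s powr p) + ennreal_powr (ennreal A / ennreal (w powr (1 / p))) (p / (p - 1))"
proof (cases "w = 0 \<or> A = 0")
  case True
  then show ?thesis
    using assms by (cases "A = 0") (auto simp: ennreal_powr_def ennreal_divide_top ennreal_zero_divide)
next
  case False
  define c q where "c = w powr (1 / p)" and "q = p / (p - 1)"
  have q: "1 < q" "1 / q + 1 / p = 1" and c: "0 < c"
    using False assms by (auto simp: c_def q_def field_simps)
  have "A * s = (A / c) * (c * s)"
    using c by simp
  also have "\<dots> \<le> (A / c) powr q / q + (c * s) powr p / p"
    using q assms c by (intro Youngs_inequality) auto
  also have "\<dots> \<le> (A / c) powr q + (c * s) powr p"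
    using q assms
    by (intro add_mono) (auto simp: divide_le_eq mult_le_cancel_left1 not_less)
  also have "(c * s) powr p = w * s powr p"
    using assms by (simp add: c_def powr_mult powr_powr)
  finally have "ennreal (A * s) \<le> ennreal ((A / c) powr q + w * s powr p)"
    by (rule ennreal_leI)
  also have "\<dots> = ennreal (w * s powr p) + ennreal ((A / c) powr q)"
    using assms by (subst ennreal_plus[symmetric]) (auto simp: add.commute)
  also have "ennreal ((A / c) powr q) = ennreal_powr (ennreal A / ennreal c) q"
    using assms c by (simp add: ennreal_powr_def divide_ennreal)
  finally show ?thesis
    by (simp add: c_def q_def)
qed

text \<open>
  Hoelder's inequality near a point that is not critical. For \<open>p = 1\<close> the finite essential
  supremum gives the linear bound \<open>\<bar>x - x0\<bar> powr \<alpha> \<le> K * w x\<close>; for \<open>p > 1\<close> Young's inequality has the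
  integrand that defines the critical set as its second term.
\<close>
lemma L1_controlled_noncritical:
  assumes w: "weight a b w" and p: "1 \<le> p"
    and x0: "x0 \<in> {a..b}" "x0 \<notin> crit_set a b p w \<alpha>"
  obtains \<epsilon> where "0 < \<epsilon>"
    "L1_controlled a b p w (\<lambda>x. indicator (ball x0 \<epsilon>) x * \<bar>x - x0\<bar> powr \<alpha>)"
proof -
  let ?M = "lebesgue_on {a<..<b}"
  obtain \<epsilon> where \<epsilon>: "0 < \<epsilon>" and fin: "crit_size a b p w \<alpha> x0 (ball x0 \<epsilon>) < \<infinity>"
    using x0 by (auto simp: crit_set_def crit_set_wrt_def less_top)
  let ?B = "ball x0 \<epsilon>" and ?S = "{a..b} \<inter> ball x0 \<epsilon>"
  let ?\<phi> = "\<lambda>x. indicator ?B x * \<bar>x - x0\<bar> powr \<alpha>"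
  have [measurable]: "w \<in> borel_measurable ?M"
    by (rule weight_borel_measurable[OF w])
  have w0: "AE x in ?M. 0 \<le> w x"
    using w by (simp add: weight_def)
  have idm: "(\<lambda>x. x) \<in> borel_measurable ?M"
    by (intro continuous_imp_measurable_on_sets_lebesgue continuous_intros) auto
  have ind: "(indicator ?B :: real \<Rightarrow> real) \<in> borel_measurable ?M"
    by (intro measurable_restrict_space1 borel_measurable_indicator) auto
  have \<phi>m: "?\<phi> \<in> borel_measurable ?M"
    using idm ind by measurable
  have "L1_controlled a b p w ?\<phi>"
  proof (cases "p = 1")
    case True
    define F where "F = (\<lambda>x. ennreal (\<bar>x - x0\<bar> powr \<alpha>) / ennreal (w x))"
    define K where "K = enn2real (esssup (lebesgue_on ?S) F)"
    have K: "esssup (lebesgue_on ?S) F = ennreal K"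
      using fin True by (simp add: crit_size_def K_def F_def less_top)
    have "AE x in lebesgue_on ?S. F x \<le> ennreal K"
      unfolding K[symmetric] by (rule esssup_AE)
    then have "AE x in lebesgue. x \<in> ?S \<longrightarrow> F x \<le> ennreal K"
      by (subst (asm) AE_restrict_space_iff) auto
    then have "AE x in ?M. x \<in> ?B \<longrightarrow> F x \<le> ennreal K"
      by (subst AE_restrict_space_iff) (auto elim!: eventually_mono)
    then have "AE x in ?M. \<forall>s\<ge>0. ennreal (?\<phi> x * s) \<le> ennreal (K * (w x * s powr p)) + 0"
      using w0
    proof eventually_elim
      case (elim x)
      have "?\<phi> x \<le> K * w x"
      proof (cases "x \<in> ?B")
        case inB: True
        show ?thesis
        proof (cases "w x = 0")
          case True
          then have "\<bar>x - x0\<bar> powr \<alpha> = 0"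
            using elim inB by (cases "\<bar>x - x0\<bar> powr \<alpha> = 0") (auto simp: F_def ennreal_divide_zero top_unique)
          then show ?thesis using True by simp
        next
          case False
          then have "\<bar>x - x0\<bar> powr \<alpha> / w x \<le> K"
            using elim inB by (simp add: F_def divide_ennreal K_def)
          then show ?thesis
            using False elim inB by (simp add: divide_le_eq)
        qed
      qed (use elim in \<open>simp add: K_def\<close>)
      then show ?case
        using True by (auto intro!: ennreal_leI mult_right_mono simp: mult.assoc[symmetric])
    qed
    then show ?thesis
      by (intro L1_controlledI[OF w p \<phi>m, of "\<lambda>_. 0" K]) (auto simp: K_def)
  next
    case False
    define F where
      "F = (\<lambda>x. ennreal_powr (ennreal (\<bar>x - x0\<bar> powr \<alpha>) / ennreal (w x powr (1 / p))) (p / (p - 1)))"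
    have Fm: "(\<lambda>x. indicator ?B x * F x) \<in> borel_measurable ?M"
    proof -
      have "F \<in> borel_measurable ?M"
        unfolding F_def using idm by measurable
      moreover have "(indicator ?B :: real \<Rightarrow> ennreal) \<in> borel_measurable ?M"
        by (intro measurable_restrict_space1 borel_measurable_indicator) auto
      ultimately show ?thesis by measurable
    qed
    have "(\<integral>\<^sup>+x. indicator ?B x * F x \<partial>?M) = (\<integral>\<^sup>+x. indicator ?B x * F x * indicator {a<..<b} x \<partial>lebesgue)"
      by (subst nn_integral_restrict_space) auto
    also have "\<dots> \<le> (\<integral>\<^sup>+x. F x * indicator ?S x \<partial>lebesgue)"
      by (intro nn_integral_mono) (auto split: split_indicator)
    also have "\<dots> = (\<integral>\<^sup>+x. F x \<partial>lebesgue_on ?S)"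
      by (subst nn_integral_restrict_space) auto
    also have "\<dots> < \<infinity>"
      using fin False by (simp add: crit_size_def F_def)
    finally have Ffin: "(\<integral>\<^sup>+x. indicator ?B x * F x \<partial>?M) < \<infinity>" .
    have "AE x in ?M. \<forall>s\<ge>0. ennreal (?\<phi> x * s) \<le> ennreal (1 * (w x * s powr p)) + indicator ?B x * F x"
      using w0
    proof eventually_elim
      case (elim x)
      then show ?case
        using False p Young_ennreal_powr[of p "\<bar>x - x0\<bar> powr \<alpha>" _ "w x"]
        by (auto simp: F_def split: split_indicator)
    qed
    then show ?thesis
      using Ffin by (intro L1_controlledI[OF w p \<phi>m Fm, of 1]) auto
  qed
  then show ?thesis
    using that \<epsilon> by blast
qed

text \<open>
  Here the pointwise inequality is \<open>s \<le> s powr p + 1\<close>, and \<open>1\<close> is integrable on the bounded interval.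
\<close>
lemma L1_controlled_lower_bound:
  assumes w: "weight a b w" and p: "1 \<le> p" and \<delta>: "0 < \<delta>" and J: "J \<in> sets lebesgue"
    and lb: "AE x in lebesgue_on {a<..<b}. x \<in> J \<longrightarrow> \<delta> \<le> w x"
  shows "L1_controlled a b p w (indicator J)"
proof -
  let ?M = "lebesgue_on {a<..<b}"
  have Jm: "(indicator J :: real \<Rightarrow> real) \<in> borel_measurable ?M"
    by (intro measurable_restrict_space1 borel_measurable_indicator J)
  have w0: "AE x in ?M. 0 \<le> w x"
    using w by (simp add: weight_def)
  have fin: "(\<integral>\<^sup>+x. 1 \<partial>?M) < \<infinity>"
    by (cases "a \<le> b") (simp_all add: emeasure_restrict_space)
  have "AE x in ?M. \<forall>s\<ge>0. ennreal (indicator J x * s) \<le> ennreal (1 / \<delta> * (w x * s powr p)) + 1"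
    using lb w0
  proof eventually_elim
    case (elim x)
    have "ennreal (indicator J x * s) \<le> ennreal (1 / \<delta> * (w x * s powr p)) + 1" if s: "0 \<le> s" for s
    proof (cases "x \<in> J")
      case True
      have le: "s \<le> s powr p + 1"
      proof (cases "s \<le> 1")
        case False
        then have "s powr 1 \<le> s powr p"
          using p by (intro powr_mono) auto
        then show ?thesis using False by simp
      qed (use powr_ge_zero[of s p] in linarith)
      have "1 * s powr p \<le> w x / \<delta> * s powr p"
        using elim True \<delta> by (intro mult_right_mono) auto
      then have "s \<le> 1 / \<delta> * (w x * s powr p) + 1"
        using le by simp
      then have "ennreal s \<le> ennreal (1 / \<delta> * (w x * s powr p) + 1)"
        by (rule ennreal_leI)
      also have "\<dots> = ennreal (1 / \<delta> * (w x * s powr p)) + 1"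
        using elim \<delta> by (subst ennreal_plus) auto
      finally show ?thesis using True by simp
    qed simp
    then show ?case by blast
  qed
  then show ?thesis
    using fin \<delta> by (intro L1_controlledI[OF w p Jm, of "\<lambda>_. 1" "1 / \<delta>"]) auto
qed

text \<open>
  The factor \<open>\<kappa>\<close> may differ from \<open>\<phi>\<close>: a constant gives a local embedding into \<open>L\<^sup>1\<close>, a power of
  the distance to an end point gives the estimate of a Taylor remainder.
\<close>
lemma L1_controlled_integral:
  assumes ctl: "L1_controlled a b p w \<phi>"
    and J: "J \<in> sets lebesgue" "J \<subseteq> {a<..<b}"
    and \<kappa>: "\<kappa> \<in> borel_measurable (lebesgue_on J)" "\<And>x. x \<in> J \<Longrightarrow> 0 \<le> \<kappa> x"
    and M: "0 \<le> M" "\<And>x. x \<in> J \<Longrightarrow> \<kappa> x \<le> M * \<phi> x"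
  obtains C where "0 \<le> C"
    "\<And>g. g \<in> Lp (weight_measure a b w) p \<Longrightarrow> integrable (lebesgue_on J) (\<lambda>x. \<kappa> x * \<bar>g x\<bar>)"
    "\<And>g. g \<in> Lp (weight_measure a b w) p \<Longrightarrow>
       (\<integral>x. \<kappa> x * \<bar>g x\<bar> \<partial>lebesgue_on J) \<le> C * Lp_norm (weight_measure a b w) p g"
proof -
  let ?W = "weight_measure a b w"
  have \<phi>m: "\<phi> \<in> borel_measurable (lebesgue_on {a<..<b})"
    using ctl by (simp add: L1_controlled_def)
  obtain C where C: "0 \<le> C" and bound: "\<And>g. g \<in> Lp ?W p \<Longrightarrow>
      (\<integral>\<^sup>+x. ennreal (\<phi> x * \<bar>g x\<bar>) \<partial>lebesgue_on {a<..<b}) \<le> ennreal (C * Lp_norm ?W p g)"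
    using ctl by (auto simp: L1_controlled_def)
  have int: "integrable (lebesgue_on J) (\<lambda>x. \<kappa> x * \<bar>g x\<bar>)"
    and le: "(\<integral>x. \<kappa> x * \<bar>g x\<bar> \<partial>lebesgue_on J) \<le> M * C * Lp_norm ?W p g"
    if g: "g \<in> Lp ?W p" for g
  proof -
    have gm: "g \<in> borel_measurable (lebesgue_on J)"
      using g J(2) by (auto simp: Lp_def intro: measurable_restrict_mono)
    have meas: "(\<lambda>x. \<kappa> x * \<bar>g x\<bar>) \<in> borel_measurable (lebesgue_on J)"
      using gm \<kappa>(1) by measurable
    have pos: "AE x in lebesgue_on J. 0 \<le> \<kappa> x * \<bar>g x\<bar>"
      using \<kappa>(2) by (intro AE_I2) auto
    have "(\<integral>\<^sup>+x. ennreal (\<kappa> x * \<bar>g x\<bar>) \<partial>lebesgue_on J) =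
        (\<integral>\<^sup>+x. ennreal (\<kappa> x * \<bar>g x\<bar>) * indicator J x \<partial>lebesgue)"
      using J by (subst nn_integral_restrict_space) auto
    also have "\<dots> \<le> (\<integral>\<^sup>+x. ennreal (M * (\<phi> x * \<bar>g x\<bar>)) * indicator {a<..<b} x \<partial>lebesgue)"
    proof (intro nn_integral_mono)
      fix x
      have "\<kappa> x * \<bar>g x\<bar> \<le> M * \<phi> x * \<bar>g x\<bar>" if "x \<in> J"
        using M(2)[OF that] by (rule mult_right_mono) auto
      then show "ennreal (\<kappa> x * \<bar>g x\<bar>) * indicator J x \<le>
          ennreal (M * (\<phi> x * \<bar>g x\<bar>)) * indicator {a<..<b} x"
        using J by (auto simp: mult.assoc intro!: ennreal_leI split: split_indicator)
    qed
    also have "\<dots> = (\<integral>\<^sup>+x. ennreal (M * (\<phi> x * \<bar>g x\<bar>)) \<partial>lebesgue_on {a<..<b})"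
      by (subst nn_integral_restrict_space) auto
    also have "\<dots> = ennreal M * (\<integral>\<^sup>+x. ennreal (\<phi> x * \<bar>g x\<bar>) \<partial>lebesgue_on {a<..<b})"
    proof -
      have "g \<in> borel_measurable (lebesgue_on {a<..<b})"
        using g by (simp add: Lp_def)
      then have "(\<lambda>x. ennreal (\<phi> x * \<bar>g x\<bar>)) \<in> borel_measurable (lebesgue_on {a<..<b})"
        using \<phi>m by measurable
      then show ?thesis
        using M(1) by (simp add: ennreal_mult' nn_integral_cmult)
    qed
    also have "\<dots> \<le> ennreal M * ennreal (C * Lp_norm ?W p g)"
      by (intro mult_left_mono bound g) auto
    finally have nn: "(\<integral>\<^sup>+x. ennreal (\<kappa> x * \<bar>g x\<bar>) \<partial>lebesgue_on J) \<le> ennreal (M * C * Lp_norm ?W p g)"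
      using M(1) by (simp add: ennreal_mult'[symmetric] mult.assoc)
    show int: "integrable (lebesgue_on J) (\<lambda>x. \<kappa> x * \<bar>g x\<bar>)"
      using meas pos le_less_trans[OF nn ennreal_less_top] by (intro integrableI_nonneg) auto
    show "(\<integral>x. \<kappa> x * \<bar>g x\<bar> \<partial>lebesgue_on J) \<le> M * C * Lp_norm ?W p g"
      using nn M(1) C nn_integral_eq_integral[OF int pos] by simp
  qed
  show ?thesis
    using that[of "M * C"] int le M(1) C by simp
qed

lemma L1_controlled_restrict:
  assumes ctl: "L1_controlled a b p w \<phi>" and c: "0 < c"
    and J: "J \<in> sets lebesgue" "J \<subseteq> {a<..<b}" and lb: "\<And>x. x \<in> J \<Longrightarrow> c \<le> \<phi> x"
  obtains C where "0 \<le> C"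
    "\<And>g. g \<in> Lp (weight_measure a b w) p \<Longrightarrow> integrable (lebesgue_on J) g"
    "\<And>g. g \<in> Lp (weight_measure a b w) p \<Longrightarrow>
       (\<integral>x. \<bar>g x\<bar> \<partial>lebesgue_on J) \<le> C * Lp_norm (weight_measure a b w) p g"
proof (rule L1_controlled_integral[OF ctl J, of "\<lambda>_. 1" "1 / c"])
  fix C
  assume C: "0 \<le> C"
    "\<And>g. g \<in> Lp (weight_measure a b w) p \<Longrightarrow> integrable (lebesgue_on J) (\<lambda>x. 1 * \<bar>g x\<bar>)"
    "\<And>g. g \<in> Lp (weight_measure a b w) p \<Longrightarrow>
       (\<integral>x. 1 * \<bar>g x\<bar> \<partial>lebesgue_on J) \<le> C * Lp_norm (weight_measure a b w) p g"
  show thesis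
  proof (rule that[OF C(1)])
    fix g assume g: "g \<in> Lp (weight_measure a b w) p"
    then have "g \<in> borel_measurable (lebesgue_on J)"
      using J(2) by (auto simp: Lp_def intro: measurable_restrict_mono)
    then show "integrable (lebesgue_on J) g"
      using C(2)[OF g] by (simp add: integrable_abs_iff)
    show "(\<integral>x. \<bar>g x\<bar> \<partial>lebesgue_on J) \<le> C * Lp_norm (weight_measure a b w) p g"
      using C(3)[OF g] by simp
  qed
qed (use c lb in \<open>auto simp: field_simps\<close>)

section \<open>Limits of derivatives, and coverings by one-sided intervals\<close>

lemma negligible_iff_AE:
  fixes S :: "'a::euclidean_space set"
  shows "negligible S \<longleftrightarrow> (AE x in lebesgue. x \<notin> S)"
proof
  assume "AE x in lebesgue. x \<notin> S"
  then obtain N where N: "S \<subseteq> N" "N \<in> null_sets (lebesgue :: 'a measure)"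
    by (auto simp: eventually_ae_filter)
  then show "negligible S"
    using negligible_iff_null_sets negligible_subset by blast
next
  assume "negligible S"
  then show "AE x in lebesgue. x \<notin> S"
    unfolding negligible_iff_null_sets by (rule AE_not_in)
qed

text \<open>
  By Lebesgue's differentiation theorem, \<open>g x\<close> is almost everywhere the limit of the averages of \<open>g\<close>
  over the intervals \<open>{x..x + h}\<close>.
\<close>
lemma AE_zero_of_interval_integrals:
  fixes g :: "real \<Rightarrow> real"
  assumes g: "g absolutely_integrable_on {l<..<r}"
    and zero: "\<And>x y. l < x \<Longrightarrow> x \<le> y \<Longrightarrow> y < r \<Longrightarrow> integral {x..y} g = 0"
  shows "AE x in lebesgue_on {l<..<r}. g x = 0"
proof -
  define G where "G = (\<lambda>x. if x \<in> {l<..<r} then g x else 0)"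
  have GU: "G absolutely_integrable_on UNIV"
    using g unfolding G_def absolutely_integrable_restrict_UNIV .
  have Gint: "G integrable_on cbox x y" for x y
    by (rule set_lebesgue_integral_eq_integral(1), rule set_integrable_subset[OF GU]) auto
  have "\<exists>N. negligible N \<and> (\<forall>x e. x \<notin> N \<longrightarrow> 0 < e \<longrightarrow>
      (\<exists>d>0. \<forall>h. 0 < h \<and> h < d \<longrightarrow> \<bar>integral {x..x + h} G / h - G x\<bar> < e))"
  proof (rule integrable_ccontinuous_explicit[OF Gint])
    fix N assume N: "negligible N" "\<And>x e. \<lbrakk>x \<notin> N; 0 < e\<rbrakk> \<Longrightarrow>
       \<exists>d>0. \<forall>h. 0 < h \<and> h < d \<longrightarrow>
          norm (integral (cbox x (x + h *\<^sub>R One)) G /\<^sub>R h ^ DIM(real) - G x) < e"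
    show ?thesis
      by (rule exI[of _ N]) (use N in \<open>simp add: divide_inverse_commute\<close>)
  qed
  then obtain N where N: "negligible N"
    and ave: "\<And>x e. x \<notin> N \<Longrightarrow> 0 < e \<Longrightarrow>
      \<exists>d>0. \<forall>h. 0 < h \<and> h < d \<longrightarrow> \<bar>integral {x..x + h} G / h - G x\<bar> < e"
    by blast
  have gz: "g x = 0" if x: "x \<in> {l<..<r}" "x \<notin> N" for x
  proof (rule ccontr)
    assume "g x \<noteq> 0"
    then obtain d where d: "0 < d"
      and h: "\<And>h. 0 < h \<Longrightarrow> h < d \<Longrightarrow> \<bar>integral {x..x + h} G / h - G x\<bar> < \<bar>g x\<bar>"
      using ave[OF x(2), of "\<bar>g x\<bar>"] by auto
    obtain k where "0 < k" "k < min d (r - x)"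
      using dense[of 0 "min d (r - x)"] d x by auto
    then have k: "0 < k" "k < d" "x + k < r"
      by auto
    have "integral {x..x + k} G = integral {x..x + k} g"
      using x k by (intro integral_cong) (auto simp: G_def)
    also have "\<dots> = 0"
      using x k by (intro zero) auto
    finally have "integral {x..x + k} G = 0" .
    moreover have "G x = g x"
      using x by (simp add: G_def)
    ultimately show False
      using h[OF k(1,2)] by simp
  qed
  have "AE x in lebesgue. x \<in> {l<..<r} \<longrightarrow> g x = 0"
    using N[unfolded negligible_iff_AE] by eventually_elim (use gz in blast)
  then show ?thesis
    by (subst AE_restrict_space_iff) auto
qed

text \<open>
  Distributional derivatives are closed in \<open>L\<^sup>1\<close>. A subsequence of \<open>f\<close> tends to zero at almost every
  point, so the fundamental theorem of calculus makes the integral of \<open>g\<close> vanish between almost all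
  end points; the indefinite integral of \<open>g\<close> is continuous, which extends this to all end points.
\<close>
lemma L1_limit_of_derivatives:
  fixes f f' :: "nat \<Rightarrow> real \<Rightarrow> real" and g :: "real \<Rightarrow> real"
  assumes der: "\<And>n x. (f n has_real_derivative f' n x) (at x)"
    and f: "\<And>n. integrable (lebesgue_on {l<..<r}) (f n)"
    and g: "integrable (lebesgue_on {l<..<r}) g"
    and f': "\<And>n. integrable (lebesgue_on {l<..<r}) (\<lambda>x. f' n x - g x)"
    and f0: "(\<lambda>n. \<integral>x. \<bar>f n x\<bar> \<partial>lebesgue_on {l<..<r}) \<longlonglongrightarrow> 0"
    and f'g: "(\<lambda>n. \<integral>x. \<bar>f' n x - g x\<bar> \<partial>lebesgue_on {l<..<r}) \<longlonglongrightarrow> 0"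
  shows "AE x in lebesgue_on {l<..<r}. g x = 0"
proof (rule AE_zero_of_interval_integrals)
  let ?J = "{l<..<r}"
  have gJ: "g absolutely_integrable_on ?J"
    using g by (simp add: set_integrable_def integrable_restrict_space)
  then show "g absolutely_integrable_on ?J" .
  have f'J: "(\<lambda>x. f' n x - g x) absolutely_integrable_on ?J" for n
    using f'[of n] by (simp add: set_integrable_def integrable_restrict_space)
  obtain s where s: "strict_mono (s :: nat \<Rightarrow> nat)"
    and ae: "AE x in lebesgue_on ?J. (\<lambda>n. f (s n) x) \<longlonglongrightarrow> 0"
    using tendsto_L1_AE_subseq[of "lebesgue_on ?J" f] f f0 by auto
  define D where "D = {x \<in> ?J. (\<lambda>n. f (s n) x) \<longlonglongrightarrow> 0}"
  have D: "negligible (?J - D)"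
  proof -
    have "AE x in lebesgue. x \<notin> ?J - D"
      using ae by (subst (asm) AE_restrict_space_iff) (auto simp: D_def elim!: eventually_mono)
    then show ?thesis
      by (simp add: negligible_iff_AE)
  qed
  have gint: "g integrable_on {x..y}" if "l < x" "y < r" for x y
    using that by (intro set_lebesgue_integral_eq_integral(1) set_integrable_subset[OF gJ]) auto
  have zeroD: "integral {x..y} g = 0" if x: "x \<in> D" and y: "y \<in> D" and xy: "x \<le> y" for x y
  proof -
    have sub: "{x..y} \<subseteq> ?J"
      using x y by (auto simp: D_def)
    have bound: "\<bar>integral {x..y} g - (f n y - f n x)\<bar> \<le> (\<integral>x. \<bar>f' n x - g x\<bar> \<partial>lebesgue_on ?J)" for n
    proof -
      have ftc: "(f' n has_integral f n y - f n x) {x..y}"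
        using xy der by (intro fundamental_theorem_of_calculus)
          (auto simp: has_real_derivative_iff_has_vector_derivative[symmetric] intro: has_field_derivative_at_within)
      have ab: "(\<lambda>x. f' n x - g x) absolutely_integrable_on {x..y}"
        by (rule set_integrable_subset[OF f'J]) (use sub in auto)
      have "f n y - f n x - integral {x..y} g = integral {x..y} (\<lambda>x. f' n x - g x)"
        using ftc gint[of x y] x y
        by (subst integral_diff) (auto simp: D_def integral_unique has_integral_integrable)
      also have "\<bar>\<dots>\<bar> \<le> integral {x..y} (\<lambda>x. \<bar>f' n x - g x\<bar>)"
        using absolutely_integrable_on_def[THEN iffD1, OF ab]
          integral_norm_bound_integral[of "\<lambda>x. f' n x - g x" "{x..y}" "\<lambda>x. \<bar>f' n x - g x\<bar>"]
        by simp
      also have "\<dots> \<le> integral ?J (\<lambda>x. \<bar>f' n x - g x\<bar>)"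
        using sub absolutely_integrable_on_def[THEN iffD1, OF ab]
          absolutely_integrable_on_def[THEN iffD1, OF f'J[of n]]
        by (intro integral_subset_le) auto
      also have "\<dots> = (\<integral>x. \<bar>f' n x - g x\<bar> \<partial>lebesgue_on ?J)"
        using f'[of n] by (intro lebesgue_integral_eq_integral[symmetric]) auto
      finally show ?thesis by (simp add: abs_minus_commute)
    qed
    have "(\<lambda>n. integral {x..y} g - (f (s n) y - f (s n) x)) \<longlonglongrightarrow> integral {x..y} g - (0 - 0)"
      using x y by (intro tendsto_intros) (auto simp: D_def)
    moreover have "(\<lambda>n. integral {x..y} g - (f (s n) y - f (s n) x)) \<longlonglongrightarrow> 0"
      by (rule Lim_null_comparison[OF _ LIMSEQ_subseq_LIMSEQ[OF f'g s, unfolded o_def]])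
         (auto intro!: always_eventually simp: bound)
    ultimately show ?thesis
      using LIMSEQ_unique[of _ "integral {x..y} g - (0 - 0)" 0] by simp
  qed
  have dense: "\<exists>z\<in>D. u < z \<and> z < v" if "l \<le> u" "u < v" "v \<le> r" for u v
  proof (rule ccontr)
    assume "\<not> ?thesis"
    then have "{u<..<v} \<subseteq> ?J - D"
      using that by auto
    then have "negligible {u<..<v}"
      using D negligible_subset by blast
    then show False
      using open_not_negligible[of "{u<..<v}"] that by auto
  qed
  show "integral {x..y} g = 0" if xy: "l < x" "x \<le> y" "y < r" for x y
  proof -
    obtain x' where x': "x' \<in> D" "l < x'" "x' < x"
      using dense[of l x] xy by auto
    obtain y' where y': "y' \<in> D" "y < y'" "y' < r"
      using dense[of y r] xy by auto
    have cont: "continuous_on {x'..y'} (\<lambda>t. integral {x'..t} g)"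
      using x' y' by (intro indefinite_integral_continuous_1 gint) auto
    have zero: "integral {x'..t} g = 0" if t: "x' < t" "t < y'" for t
    proof (rule ccontr)
      assume ne: "integral {x'..t} g \<noteq> 0"
      obtain d where d: "0 < d" and near: "\<And>z. z \<in> {x'..y'} \<Longrightarrow> dist z t < d \<Longrightarrow>
           dist (integral {x'..z} g) (integral {x'..t} g) < \<bar>integral {x'..t} g\<bar>"
      proof -
        have "\<exists>d>0. \<forall>z\<in>{x'..y'}. dist z t < d \<longrightarrow>
            dist (integral {x'..z} g) (integral {x'..t} g) < \<bar>integral {x'..t} g\<bar>"
          using cont[unfolded continuous_on_iff] t ne by simp
        then show ?thesis using that by blast
      qed
      obtain z where z: "z \<in> D" "t < z" "z < min (t + d) y'"
        using dense[of t "min (t + d) y'"] t x' y' d by (auto simp: min_le_iff_disj)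
      have "integral {x'..z} g = 0"
        using z x' t by (intro zeroD) auto
      then show False
        using near[of z] z t by (auto simp: dist_real_def)
    qed
    have "integral {x'..x} g + integral {x..y} g = integral {x'..y} g"
      using x' xy by (intro Henstock_Kurzweil_Integration.integral_combine gint) auto
    moreover have "integral {x'..x} g = 0" "integral {x'..y} g = 0"
      using zero[of x] zero[of y] x' y' xy by auto
    ultimately show ?thesis by simp
  qed
qed

lemma countable_disjoint_open_family:
  fixes U :: "'i \<Rightarrow> 'a::second_countable_topology set"
  assumes op: "\<And>x. x \<in> A \<Longrightarrow> open (U x)" and ne: "\<And>x. x \<in> A \<Longrightarrow> U x \<noteq> {}"
    and disj: "\<And>x y. x \<in> A \<Longrightarrow> y \<in> A \<Longrightarrow> x \<noteq> y \<Longrightarrow> U x \<inter> U y = {}"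
  shows "countable A"
proof -
  have "countable (U ` A)"
  proof (rule countable_disjoint_open_subsets)
    show "pairwise disjnt (U ` A)"
    proof (rule pairwiseI)
      fix S T assume "S \<in> U ` A" "T \<in> U ` A" "S \<noteq> T"
      then obtain x y where "x \<in> A" "y \<in> A" "S = U x" "T = U y" "x \<noteq> y"
        by blast
      then show "disjnt S T"
        using disj by (simp add: disjnt_def)
    qed
  qed (use op in auto)
  moreover have "inj_on U A"
  proof (rule inj_onI, rule ccontr)
    fix x y assume "x \<in> A" "y \<in> A" "U x = U y" "x \<noteq> y"
    then show False
      using disj[of x y] ne[of x] by simp
  qed
  ultimately show ?thesis
    using countable_image_inj_on by blast
qed

text \<open>
  The open intervals on which \<open>Z\<close> is negligible have, by Lindelof's theorem, a union \<open>\<Union>\<U>\<close> on which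
  \<open>Z\<close> is negligible. The points of \<open>S\<close> outside \<open>\<Union>\<U>\<close> are only countably many: their right (or left)
  neighbourhoods lie in \<open>\<Union>\<U>\<close>, thus contain no further such point, and are therefore pairwise
  disjoint.
\<close>
lemma negligible_one_sided_cover:
  fixes S Z :: "real set"
  assumes "\<And>x. x \<in> S \<Longrightarrow> \<exists>r>0. negligible (Z \<inter> {x<..<x + r}) \<or> negligible (Z \<inter> {x - r<..<x})"
  shows "negligible (Z \<inter> S)"
proof -
  define \<U> where "\<U> = {{p<..<q} | p q :: real. negligible (Z \<inter> {p<..<q})}"
  have op: "\<And>T. T \<in> \<U> \<Longrightarrow> open T"
    by (auto simp: \<U>_def)
  obtain \<V> where \<V>: "\<V> \<subseteq> \<U>" "countable \<V>" "\<Union>\<V> = \<Union>\<U>"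
    using Lindelof[of \<U>] op by auto
  have "negligible (\<Union>T\<in>\<V>. Z \<inter> T)"
    using \<V> by (intro negligible_countable_Union[of "(\<lambda>T. Z \<inter> T) ` \<V>"]) (auto simp: \<U>_def)
  then have neg: "negligible (Z \<inter> \<Union>\<U>)"
    using \<V>(3) by (simp add: Int_UN_distrib[symmetric])
  define R where "R = {x \<in> S - \<Union>\<U>. \<exists>r>0. {x<..<x + r} \<in> \<U>}"
  define L where "L = {x \<in> S - \<Union>\<U>. \<exists>r>0. {x - r<..<x} \<in> \<U>}"
  have "countable R"
  proof -
    obtain r where r: "\<And>x. x \<in> R \<Longrightarrow> 0 < r x \<and> {x<..<x + r x} \<in> \<U>"
      unfolding R_def by (atomize_elim, intro choice) blast
    have disj: "{x<..<x + r x} \<inter> {y<..<y + r y} = {}" if "x \<in> R" "y \<in> R" "x < y" for x y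
    proof -
      have "y \<notin> {x<..<x + r x}"
        using r[OF that(1)] that(2) by (auto simp: R_def)
      then show ?thesis using that by auto
    qed
    show ?thesis
    proof (rule countable_disjoint_open_family)
      show "{x<..<x + r x} \<inter> {y<..<y + r y} = {}" if "x \<in> R" "y \<in> R" "x \<noteq> y" for x y
        using disj[of x y] disj[of y x] that by (cases "x < y") auto
    qed (use r in \<open>fastforce+\<close>)
  qed
  moreover have "countable L"
  proof -
    obtain r where r: "\<And>x. x \<in> L \<Longrightarrow> 0 < r x \<and> {x - r x<..<x} \<in> \<U>"
      unfolding L_def by (atomize_elim, intro choice) blast
    have disj: "{x - r x<..<x} \<inter> {y - r y<..<y} = {}" if "x \<in> L" "y \<in> L" "x < y" for x y
    proof -
      have "x \<notin> {y - r y<..<y}"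
        using r[OF that(2)] that(1) by (auto simp: L_def)
      then show ?thesis using that by auto
    qed
    show ?thesis
    proof (rule countable_disjoint_open_family)
      show "{x - r x<..<x} \<inter> {y - r y<..<y} = {}" if "x \<in> L" "y \<in> L" "x \<noteq> y" for x y
        using disj[of x y] disj[of y x] that by (cases "x < y") auto
    qed (use r in \<open>fastforce+\<close>)
  qed
  moreover have cover: "S \<subseteq> \<Union>\<U> \<union> R \<union> L"
  proof
    fix x assume x: "x \<in> S"
    then obtain r where "0 < r" and r: "{x<..<x + r} \<in> \<U> \<or> {x - r<..<x} \<in> \<U>"
      using assms[OF x] unfolding \<U>_def by blast
    then show "x \<in> \<Union>\<U> \<union> R \<union> L"
      using x by (auto simp: R_def L_def)
  qed
  ultimately have "negligible (R \<union> L)"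
    by (simp add: countable_imp_null_set_lborel null_sets_completionI negligible_iff_null_sets)
  then have "negligible (Z \<inter> \<Union>\<U> \<union> R \<union> L)"
    using neg by (simp add: Un_assoc)
  then show ?thesis
    by (rule negligible_subset) (use cover in auto)
qed

section \<open>Uniqueness of the derivatives for stable weights\<close>

text \<open>
  On an interval where the factor \<open>\<phi>\<close> is bounded below, convergence in the weighted space implies
  convergence in \<open>L\<^sup>1\<close>, so that the closedness of the derivative in \<open>L\<^sup>1\<close> applies.
\<close>
lemma L1_controlled_limit_zero:
  fixes f f' :: "nat \<Rightarrow> real \<Rightarrow> real"
  assumes p: "1 \<le> p"
    and der: "\<And>n x. (f n has_real_derivative f' n x) (at x)"
    and f0: "Lp_tendsto (weight_measure a b w) p f (\<lambda>_. 0)"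
    and f'g: "Lp_tendsto (weight_measure a b w) p f' g"
    and ctl: "L1_controlled a b p w \<phi>" and c: "0 < c"
    and J: "{l<..<r} \<subseteq> {a<..<b}" and lb: "\<And>x. x \<in> {l<..<r} \<Longrightarrow> c \<le> \<phi> x"
  shows "negligible ({x. g x \<noteq> 0} \<inter> {l<..<r})"
proof -
  let ?W = "weight_measure a b w" and ?J = "lebesgue_on {l<..<r}"
  obtain C where C: "0 \<le> C"
    and int: "\<And>h. h \<in> Lp ?W p \<Longrightarrow> integrable ?J h"
    and bound: "\<And>h. h \<in> Lp ?W p \<Longrightarrow> (\<integral>x. \<bar>h x\<bar> \<partial>?J) \<le> C * Lp_norm ?W p h"
    using L1_controlled_restrict[OF ctl c, of "{l<..<r}"] J lb by auto
  have L: "f n \<in> Lp ?W p" "f' n \<in> Lp ?W p" "g \<in> Lp ?W p" for n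
    using f0 f'g by (auto simp: Lp_tendsto_def)
  have Ld: "(\<lambda>x. f' n x - g x) \<in> Lp ?W p" for n
    using p by (intro Lp_diff L) auto
  have conv: "(\<lambda>n. \<integral>x. \<bar>h n x\<bar> \<partial>?J) \<longlonglongrightarrow> 0"
    if "\<And>n. h n \<in> Lp ?W p" "(\<lambda>n. Lp_norm ?W p (h n)) \<longlonglongrightarrow> 0" for h
  proof (rule tendsto_sandwich[OF _ _ tendsto_const])
    show "(\<lambda>n. C * Lp_norm ?W p (h n)) \<longlonglongrightarrow> 0"
      using tendsto_mult_left[OF that(2), of C] by simp
  qed (auto intro!: always_eventually bound that)
  have "AE x in ?J. g x = 0"
  proof (rule L1_limit_of_derivatives[OF der])
    show "(\<lambda>n. \<integral>x. \<bar>f n x\<bar> \<partial>?J) \<longlonglongrightarrow> 0"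
      using f0 by (intro conv L) (auto simp: Lp_tendsto_def)
    show "(\<lambda>n. \<integral>x. \<bar>f' n x - g x\<bar> \<partial>?J) \<longlonglongrightarrow> 0"
      using f'g by (intro conv Ld) (auto simp: Lp_tendsto_def)
  qed (intro int L Ld)+
  then have "AE x in lebesgue. x \<in> {l<..<r} \<longrightarrow> g x = 0"
    by (subst (asm) AE_restrict_space_iff) auto
  then show ?thesis
    unfolding negligible_iff_AE by eventually_elim auto
qed

text \<open>
  Closedness of the derivative in the weighted space, which may fail without stability. Each point has
  a one-sided neighbourhood on which the limit vanishes: near a point that is not critical by the local
  embedding into \<open>L\<^sup>1\<close>, and on the stable side of a critical point by the monotonicity of the weight.
\<close>
lemma derivative_limit_zero:
  fixes f f' :: "nat \<Rightarrow> real \<Rightarrow> real"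
  assumes stable: "stable_weight a b p w" and p: "1 \<le> p"
    and der: "\<And>n x. (f n has_real_derivative f' n x) (at x)"
    and f0: "Lp_tendsto (weight_measure a b w) p f (\<lambda>_. 0)"
    and f'g: "Lp_tendsto (weight_measure a b w) p f' g"
  shows "AE x in weight_measure a b w. g x = 0"
proof -
  have w: "weight a b w"
    using stable by (simp add: stable_weight_def)
  define Z where "Z = {x \<in> {a<..<b}. 0 < w x \<and> g x \<noteq> 0}"
  note local_zero = L1_controlled_limit_zero[OF p der f0 f'g]
  \<comment> \<open>On a good interval the limit vanishes: either the weighted measure is zero there, or the weight is bounded below.\<close>
  define good where "good v l r \<longleftrightarrow>
    (\<forall>x\<in>{l<..<r}. v x \<le> 0) \<or> (\<exists>\<delta>>0. \<forall>x\<in>{l<..<r}. \<delta> \<le> v x)" for v :: "real \<Rightarrow> real" and l r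
  have good_zero: "negligible (Z \<inter> {l<..<r})"
    if v: "AE x in lebesgue_on {a<..<b}. v x = w x" and sub: "{l<..<r} \<subseteq> {a<..<b}" and "good v l r"
    for l r and v :: "real \<Rightarrow> real"
    using \<open>good v l r\<close> unfolding good_def
  proof
    assume v0: "\<forall>x\<in>{l<..<r}. v x \<le> 0"
    have "AE x in lebesgue. x \<in> {a<..<b} \<longrightarrow> v x = w x"
      using v by (subst (asm) AE_restrict_space_iff) auto
    then have "AE x in lebesgue. x \<notin> Z \<inter> {l<..<r}"
      by eventually_elim (use v0 in \<open>force simp: Z_def\<close>)
    then show ?thesis
      by (simp add: negligible_iff_AE)
  next
    assume "\<exists>\<delta>>0. \<forall>x\<in>{l<..<r}. \<delta> \<le> v x"
    then obtain \<delta> where \<delta>: "0 < \<delta>" and v\<delta>: "\<forall>x\<in>{l<..<r}. \<delta> \<le> v x"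
      by blast
    have "AE x in lebesgue_on {a<..<b}. x \<in> {l<..<r} \<longrightarrow> \<delta> \<le> w x"
      using v by eventually_elim (use v\<delta> in force)
    then have "L1_controlled a b p w (indicator {l<..<r})"
      by (intro L1_controlled_lower_bound[OF w p \<delta>]) auto
    then have "negligible ({x. g x \<noteq> 0} \<inter> {l<..<r})"
      by (rule local_zero[of _ 1]) (use sub in auto)
    then show ?thesis
      by (rule negligible_subset) (auto simp: Z_def)
  qed
  have half_good_zero: "negligible (Z \<inter> {s<..<t})"
    if v: "AE x in lebesgue_on {a<..<b}. v x = w x" and sub: "{s<..<t} \<subseteq> {a<..<b}"
      and half: "\<And>y. y \<in> {s<..<t} \<Longrightarrow> good v s y \<or> good v y t"
    for s t and v :: "real \<Rightarrow> real"
  proof (rule negligible_one_sided_cover)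
    fix y assume y: "y \<in> {s<..<t}"
    show "\<exists>r>0. negligible (Z \<inter> {y<..<y + r}) \<or> negligible (Z \<inter> {y - r<..<y})"
      using half[OF y]
    proof
      assume "good v s y"
      moreover have "{s<..<y} \<subseteq> {a<..<b}"
        using y by (intro order_trans[OF _ sub]) auto
      ultimately have "negligible (Z \<inter> {s<..<y})"
        by (intro good_zero[OF v])
      then show ?thesis
        using y by (intro exI[of _ "y - s"]) auto
    next
      assume "good v y t"
      moreover have "{y<..<t} \<subseteq> {a<..<b}"
        using y by (intro order_trans[OF _ sub]) auto
      ultimately have "negligible (Z \<inter> {y<..<t})"
        by (intro good_zero[OF v])
      then show ?thesis
        using y by (intro exI[of _ "t - y"]) auto
    qed
  qed
  have "negligible (Z \<inter> {a<..<b})"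
  proof (rule negligible_one_sided_cover)
    fix x0 assume x0: "x0 \<in> {a<..<b}"
    show "\<exists>r>0. negligible (Z \<inter> {x0<..<x0 + r}) \<or> negligible (Z \<inter> {x0 - r<..<x0})"
    proof (cases "x0 \<in> crit_set a b p w 0")
      case False
      then obtain \<epsilon> where \<epsilon>: "0 < \<epsilon>"
        and ctl: "L1_controlled a b p w (\<lambda>x. indicator (ball x0 \<epsilon>) x * \<bar>x - x0\<bar> powr 0)"
        using L1_controlled_noncritical[OF w p, of x0 0] x0 by auto
      \<comment> \<open>A one-sided interval, because the controlled factor is \<open>0 powr 0 = 0\<close> at \<open>x0\<close> itself.\<close>
      define r where "r = min \<epsilon> (b - x0)"
      have "negligible ({x. g x \<noteq> 0} \<inter> {x0<..<x0 + r})"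
        by (rule local_zero[OF ctl, of 1]) (use x0 in \<open>auto simp: r_def dist_real_def\<close>)
      then have "negligible (Z \<inter> {x0<..<x0 + r})"
        by (rule negligible_subset) (auto simp: Z_def)
      moreover have "0 < r"
        using \<epsilon> x0 by (simp add: r_def)
      ultimately show ?thesis by blast
    next
      case True
      then consider "one_sided_stable right_nb a b p w x0" | "one_sided_stable left_nb a b p w x0"
        using stable by (auto simp: stable_weight_def)
      then show ?thesis
      proof cases
        case 1
        then obtain r v where r: "0 < r" and v: "AE x in lebesgue_on {a<..<b}. v x = w x"
          and mono: "\<forall>x \<in> {x0<..<x0 + r} \<inter> {a<..<b}. \<forall>y \<in> {x0<..<x0 + r} \<inter> {a<..<b}.
             \<bar>x - x0\<bar> \<le> \<bar>y - x0\<bar> \<longrightarrow> v x \<le> v y"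
          unfolding one_sided_stable_def right_nb_def by blast
        \<comment> \<open>The value \<open>v y\<close> decides: if it is not positive, neither is \<open>v\<close> to the left of \<open>y\<close>; otherwise it is a lower bound to the right.\<close>
        define t where "t = min (x0 + r) b"
        have "negligible (Z \<inter> {x0<..<t})"
        proof (rule half_good_zero[OF v])
          fix y assume y: "y \<in> {x0<..<t}"
          have mono': "v x \<le> v z" if "x \<in> {x0<..<t}" "z \<in> {x0<..<t}" "x \<le> z" for x z
            using that x0 by (intro mono[rule_format]) (auto simp: t_def)
          show "good v x0 y \<or> good v y t"
          proof (cases "v y \<le> 0")
            case True
            have "v x \<le> 0" if "x \<in> {x0<..<y}" for x
              using mono'[of x y] that y True by auto
            then show ?thesis by (simp add: good_def)
          next
            case False
            have "v y \<le> v x" if "x \<in> {y<..<t}" for x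
              using mono'[of y x] that y by auto
            then show ?thesis
              using False unfolding good_def by (meson not_le)
          qed
        qed (use x0 in \<open>auto simp: t_def\<close>)
        moreover have "0 < t - x0"
          using r x0 by (simp add: t_def)
        ultimately show ?thesis
          by (intro exI[of _ "t - x0"]) auto
      next
        case 2
        then obtain r v where r: "0 < r" and v: "AE x in lebesgue_on {a<..<b}. v x = w x"
          and mono: "\<forall>x \<in> {x0 - r<..<x0} \<inter> {a<..<b}. \<forall>y \<in> {x0 - r<..<x0} \<inter> {a<..<b}.
             \<bar>x - x0\<bar> \<le> \<bar>y - x0\<bar> \<longrightarrow> v x \<le> v y"
          unfolding one_sided_stable_def left_nb_def by blast
        define s where "s = max (x0 - r) a"
        have "negligible (Z \<inter> {s<..<x0})"
        proof (rule half_good_zero[OF v])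
          fix y assume y: "y \<in> {s<..<x0}"
          have mono': "v z \<le> v x" if "x \<in> {s<..<x0}" "z \<in> {s<..<x0}" "x \<le> z" for x z
            using that x0 by (intro mono[rule_format]) (auto simp: s_def)
          show "good v s y \<or> good v y x0"
          proof (cases "v y \<le> 0")
            case True
            have "v x \<le> 0" if "x \<in> {y<..<x0}" for x
              using mono'[of y x] that y True by auto
            then show ?thesis by (simp add: good_def)
          next
            case False
            have "v y \<le> v x" if "x \<in> {s<..<y}" for x
              using mono'[of x y] that y by auto
            then show ?thesis
              using False unfolding good_def by (meson not_le)
          qed
        qed (use x0 in \<open>auto simp: s_def\<close>)
        moreover have "0 < x0 - s"
          using r x0 by (simp add: s_def)
        ultimately show ?thesis
          by (intro exI[of _ "x0 - s"]) auto
      qed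
    qed
  qed
  then have "AE x in lebesgue. x \<notin> Z \<inter> {a<..<b}"
    by (simp add: negligible_iff_AE)
  then have "AE x in lebesgue. x \<in> {a<..<b} \<longrightarrow> 0 < w x \<longrightarrow> g x = 0"
    by eventually_elim (auto simp: Z_def)
  then show ?thesis
    by (subst AE_weight_measure_iff[OF w], subst AE_restrict_space_iff) auto
qed

section \<open>The trace estimate for smooth functions\<close>

lemma Taylor_bound_right:
  fixes D :: "nat \<Rightarrow> real \<Rightarrow> real"
  assumes der: "\<And>i t. (D i has_real_derivative D (Suc i) t) (at t)"
    and n: "0 < n" and xy: "x \<le> y"
  shows "\<bar>D 0 y\<bar> \<le> (\<Sum>i<n. (y - x) ^ i * \<bar>D i x\<bar>) + integral {x..y} (\<lambda>t. (y - t) ^ (n - 1) * \<bar>D n t\<bar>)"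
proof -
  have cont: "continuous_on S (D i)" for S i
    using der by (meson DERIV_continuous_on has_field_derivative_at_within)
  define R where "R = (\<lambda>t. ((y - t) ^ (n - 1) / fact (n - 1)) *\<^sub>R D n t)"
  have vder: "\<And>i t. i < n \<Longrightarrow> x \<le> t \<Longrightarrow> t \<le> y \<Longrightarrow> (D i has_vector_derivative D (Suc i) t) (at t within {x..y})"
    using der by (auto simp: has_real_derivative_iff_has_vector_derivative[symmetric] intro: has_field_derivative_at_within)
  have T: "D 0 y = (\<Sum>i<n. ((y - x) ^ i / fact i) *\<^sub>R D i x) + integral {x..y} R"
    unfolding R_def by (rule Taylor_integral[where Df = D and f = "D 0", OF n refl vder xy])
  have Rint: "R integrable_on {x..y}"
    unfolding R_def by (rule Taylor_integrable[where Df = D and f = "D 0", OF n refl vder xy])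
  have Bint: "(\<lambda>t. (y - t) ^ (n - 1) * \<bar>D n t\<bar>) integrable_on {x..y}"
    by (intro integrable_continuous_interval continuous_intros cont)
  have fact: "r / fact i \<le> r" if "0 \<le> r" for r :: real and i
    using that fact_ge_1[of i, where 'a = real] by (simp add: divide_le_eq mult_le_cancel_left1)
  have "norm (integral {x..y} R) \<le> integral {x..y} (\<lambda>t. (y - t) ^ (n - 1) * \<bar>D n t\<bar>)"
  proof (rule integral_norm_bound_integral[OF Rint Bint])
    fix t assume "t \<in> {x..y}"
    then show "norm (R t) \<le> (y - t) ^ (n - 1) * \<bar>D n t\<bar>"
      by (auto simp: R_def abs_mult intro!: mult_right_mono fact)
  qed
  moreover have "\<bar>\<Sum>i<n. ((y - x) ^ i / fact i) *\<^sub>R D i x\<bar> \<le> (\<Sum>i<n. (y - x) ^ i * \<bar>D i x\<bar>)"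
    using xy by (intro order_trans[OF sum_abs] sum_mono) (auto simp: abs_mult intro!: mult_right_mono fact)
  ultimately show ?thesis
    unfolding T by simp
qed

text \<open>
  For an expansion point to the right of \<open>y\<close> the formula follows by reflecting the functions. Both
  sides are needed as \<open>y\<close> may be either end point of the interval.
\<close>
lemma Taylor_bound:
  fixes D :: "nat \<Rightarrow> real \<Rightarrow> real"
  assumes der: "\<And>i t. (D i has_real_derivative D (Suc i) t) (at t)" and n: "0 < n"
  shows "\<bar>D 0 y\<bar> \<le> (\<Sum>i<n. \<bar>y - x\<bar> ^ i * \<bar>D i x\<bar>) +
    integral {min x y..max x y} (\<lambda>t. \<bar>y - t\<bar> ^ (n - 1) * \<bar>D n t\<bar>)"
proof (cases "x \<le> y")
  case True
  have "integral {x..y} (\<lambda>t. (y - t) ^ (n - 1) * \<bar>D n t\<bar>) = integral {x..y} (\<lambda>t. \<bar>y - t\<bar> ^ (n - 1) * \<bar>D n t\<bar>)"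
    by (intro integral_cong) auto
  then show ?thesis
    using Taylor_bound_right[where D = D, OF der n True] True by simp
next
  case False
  define E where "E = (\<lambda>i t. (- 1) ^ i * D i (- t))"
  have E: "(E i has_real_derivative E (Suc i) t) (at t)" for i t
    unfolding E_def by (auto intro!: derivative_eq_intros DERIV_chain2[OF der])
  have "integral {- x..- y} (\<lambda>t. (- y - t) ^ (n - 1) * \<bar>E n t\<bar>) =
      integral {- x..- y} (\<lambda>t. \<bar>y - (- t)\<bar> ^ (n - 1) * \<bar>D n (- t)\<bar>)"
    by (intro integral_cong) (auto simp: E_def abs_mult power_abs)
  also have "\<dots> = integral {y..x} (\<lambda>t. \<bar>y - t\<bar> ^ (n - 1) * \<bar>D n t\<bar>)"
    by (rule Henstock_Kurzweil_Integration.integral_reflect_real[where f = "\<lambda>t. \<bar>y - t\<bar> ^ (n - 1) * \<bar>D n t\<bar>"])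
  finally show ?thesis
    using Taylor_bound_right[where D = E, OF E n, of "- x" "- y"] False
    by (simp add: E_def abs_mult power_abs)
qed

text \<open>
  Expansion points for Taylor's formula at \<open>x0\<close>: they keep a distance \<open>\<rho>\<close> from \<open>x0\<close>, so that a power of
  this distance is bounded below on them, and the remainder only involves the given neighbourhood.
\<close>
lemma interior_interval_near:
  fixes a b x0 \<epsilon> :: real
  assumes "a < b" "x0 \<in> {a..b}" "0 < \<epsilon>"
  obtains c d \<rho> where "c < d" "0 < \<rho>" "\<And>x. x \<in> {c..d} \<Longrightarrow> \<rho> \<le> \<bar>x - x0\<bar>"
    "{c..d} \<subseteq> {a<..<b} \<inter> ball x0 \<epsilon>"
    "\<And>x. x \<in> {c..d} \<Longrightarrow> {min x x0<..<max x x0} \<subseteq> {a<..<b} \<inter> ball x0 \<epsilon> - {x0}"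
proof (cases "x0 < b")
  case True
  define \<eta> where "\<eta> = min \<epsilon> (b - x0)"
  have \<eta>: "0 < \<eta>" "\<eta> \<le> \<epsilon>" "x0 + \<eta> \<le> b"
    using True assms by (auto simp: \<eta>_def)
  show ?thesis
    by (rule that[of "x0 + \<eta> / 3" "x0 + \<eta> / 2" "\<eta> / 3"]) (use \<eta> assms in \<open>auto simp: dist_real_def\<close>)
next
  case False
  define \<eta> where "\<eta> = min \<epsilon> (b - a)"
  have \<eta>: "0 < \<eta>" "\<eta> \<le> \<epsilon>" "a \<le> x0 - \<eta>" "x0 = b"
    using False assms by (auto simp: \<eta>_def)
  show ?thesis
    by (rule that[of "x0 - \<eta> / 2" "x0 - \<eta> / 3" "\<eta> / 3"]) (use \<eta> assms in \<open>auto simp: dist_real_def\<close>)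
qed

text \<open>
  Taylor's formula at a well-chosen point \<open>x\<close>. The lower order terms cannot be estimated at a given
  point, but their sum has a minimum on \<open>{c..d}\<close>, which is at most its average there and hence controlled.
  The bound is uniform in the functions \<open>D i\<close>, on which neither \<open>{c..d}\<close> nor the control depends.
\<close>
lemma trace_bound:
  assumes w: "weight a b w" and p: "1 \<le> p" and ab: "a < b"
    and x0: "x0 \<in> {a..b}" "x0 \<notin> crit_set a b p w \<alpha>"
    and n: "0 < n" and \<alpha>: "0 \<le> \<alpha>" "\<alpha> \<le> real n - 1"
  obtains C where "0 \<le> C"
    "\<And>D. (\<And>i t. (D i has_real_derivative D (Suc i) t) (at t)) \<Longrightarrow>
       (\<And>i. D i \<in> Lp (weight_measure a b w) p) \<Longrightarrow>
       \<bar>D 0 x0\<bar> \<le> C * (\<Sum>i\<le>n. Lp_norm (weight_measure a b w) p (D i))"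
proof -
  let ?N = "Lp_norm (weight_measure a b w) p"
  obtain \<epsilon> where \<epsilon>: "0 < \<epsilon>"
    and ctl: "L1_controlled a b p w (\<lambda>x. indicator (ball x0 \<epsilon>) x * \<bar>x - x0\<bar> powr \<alpha>)"
    using L1_controlled_noncritical[OF w p x0] by blast
  obtain c d \<rho> where cd: "c < d" and \<rho>: "0 < \<rho>" "\<And>x. x \<in> {c..d} \<Longrightarrow> \<rho> \<le> \<bar>x - x0\<bar>"
    and K: "{c..d} \<subseteq> {a<..<b} \<inter> ball x0 \<epsilon>"
    and seg: "\<And>x. x \<in> {c..d} \<Longrightarrow> {min x x0<..<max x x0} \<subseteq> {a<..<b} \<inter> ball x0 \<epsilon> - {x0}"
    using interior_interval_near[OF ab x0(1) \<epsilon>] by blast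
  \<comment> \<open>The point \<open>x0\<close> is removed because for \<open>\<alpha> = 0\<close> the control degenerates there: \<open>0 powr 0 = 0\<close>.\<close>
  define J where "J = {a<..<b} \<inter> ball x0 \<epsilon> - {x0}"
  \<comment> \<open>The summand \<open>1\<close> makes the powers of the base increase, so that \<open>M\<close> dominates all of them.\<close>
  define M where "M = (1 + (b - a)) ^ n"
  have M: "1 \<le> M"
    using ab by (simp add: M_def)
  have dist_M: "\<bar>x0 - x\<bar> ^ i \<le> M" if "x \<in> {a..b}" "i \<le> n" for x i
  proof -
    have "\<bar>x0 - x\<bar> ^ i \<le> (1 + (b - a)) ^ i"
      using x0 that by (intro power_mono) auto
    also have "\<dots> \<le> M"
      unfolding M_def using ab that by (intro power_increasing) auto
    finally show ?thesis .
  qed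
  obtain C1 where C1: "0 \<le> C1"
    and int1: "\<And>g. g \<in> Lp (weight_measure a b w) p \<Longrightarrow> integrable (lebesgue_on {c..d}) g"
    and le1: "\<And>g. g \<in> Lp (weight_measure a b w) p \<Longrightarrow> (\<integral>x. \<bar>g x\<bar> \<partial>lebesgue_on {c..d}) \<le> C1 * ?N g"
  proof (rule L1_controlled_restrict[OF ctl, of "\<rho> powr \<alpha>" "{c..d}"])
    fix x assume x: "x \<in> {c..d}"
    then have "x \<in> ball x0 \<epsilon>"
      using K by blast
    then show "\<rho> powr \<alpha> \<le> indicator (ball x0 \<epsilon>) x * \<bar>x - x0\<bar> powr \<alpha>"
      using \<rho>(1) \<rho>(2)[OF x] \<alpha> by (auto intro!: powr_mono2)
  qed (use K \<rho> in auto)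
  obtain C2 where C2: "0 \<le> C2"
    and int2: "\<And>g. g \<in> Lp (weight_measure a b w) p \<Longrightarrow>
      integrable (lebesgue_on J) (\<lambda>t. \<bar>x0 - t\<bar> ^ (n - 1) * \<bar>g t\<bar>)"
    and le2: "\<And>g. g \<in> Lp (weight_measure a b w) p \<Longrightarrow>
      (\<integral>t. \<bar>x0 - t\<bar> ^ (n - 1) * \<bar>g t\<bar> \<partial>lebesgue_on J) \<le> C2 * ?N g"
  proof (rule L1_controlled_integral[OF ctl, of J "\<lambda>t. \<bar>x0 - t\<bar> ^ (n - 1)" "(1 + (b - a)) powr (real n - 1 - \<alpha>)"])
    show "(\<lambda>t. \<bar>x0 - t\<bar> ^ (n - 1)) \<in> borel_measurable (lebesgue_on J)"
      by (intro continuous_imp_measurable_on_sets_lebesgue continuous_intros) (auto simp: J_def)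
  next
    fix t assume t: "t \<in> J"
    then have pos: "0 < \<bar>x0 - t\<bar>"
      by (auto simp: J_def)
    have "\<bar>x0 - t\<bar> ^ (n - 1) = \<bar>x0 - t\<bar> powr (real n - 1)"
      using pos n by (simp add: powr_realpow[symmetric] of_nat_diff)
    also have "\<dots> = \<bar>x0 - t\<bar> powr (real n - 1 - \<alpha>) * \<bar>x0 - t\<bar> powr \<alpha>"
      by (simp add: powr_add[symmetric])
    also have "\<dots> \<le> (1 + (b - a)) powr (real n - 1 - \<alpha>) * \<bar>x0 - t\<bar> powr \<alpha>"
      using \<alpha> t x0 by (intro mult_right_mono powr_mono2) (auto simp: J_def)
    finally show "\<bar>x0 - t\<bar> ^ (n - 1) \<le>
        (1 + (b - a)) powr (real n - 1 - \<alpha>) * (indicator (ball x0 \<epsilon>) t * \<bar>t - x0\<bar> powr \<alpha>)"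
      using t by (simp add: J_def abs_minus_commute)
  qed (auto simp: J_def)
  define C where "C = M * C1 / (d - c) + C2"
  have "\<bar>D 0 x0\<bar> \<le> C * (\<Sum>i\<le>n. ?N (D i))"
    if der: "\<And>i t. (D i has_real_derivative D (Suc i) t) (at t)"
      and L: "\<And>i. D i \<in> Lp (weight_measure a b w) p" for D
  proof -
    have cont: "continuous_on S (D i)" for S i
      using der by (meson DERIV_continuous_on has_field_derivative_at_within)
    define F where "F = (\<lambda>x. \<Sum>i<n. \<bar>D i x\<bar>)"
    have Fcont: "continuous_on {c..d} F"
      unfolding F_def by (intro continuous_intros cont)
    obtain x where x: "x \<in> {c..d}" and xmin: "\<And>y. y \<in> {c..d} \<Longrightarrow> F x \<le> F y"
      using continuous_attains_inf[OF compact_Icc _ Fcont] cd by auto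
    have "(d - c) * F x = (\<integral>y. F x \<partial>lebesgue_on {c..d})"
      using cd by (simp add: measure_restrict_space)
    also have "\<dots> \<le> (\<integral>y. F y \<partial>lebesgue_on {c..d})"
    proof (rule integral_mono)
      show "integrable (lebesgue_on {c..d}) F"
        unfolding F_def by (intro Bochner_Integration.integrable_sum integrable_abs int1 L)
    qed (use xmin in auto)
    also have "\<dots> = (\<Sum>i<n. \<integral>y. \<bar>D i y\<bar> \<partial>lebesgue_on {c..d})"
      unfolding F_def by (intro Bochner_Integration.integral_sum integrable_abs int1 L)
    also have "\<dots> \<le> (\<Sum>i<n. C1 * ?N (D i))"
      by (intro sum_mono le1 L)
    finally have "(d - c) * F x \<le> C1 * (\<Sum>i<n. ?N (D i))"
      by (simp add: sum_distrib_left)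
    then have F: "F x \<le> C1 / (d - c) * (\<Sum>i<n. ?N (D i))"
      using cd by (simp add: pos_le_divide_eq mult.commute)
    have "(\<Sum>i<n. \<bar>x0 - x\<bar> ^ i * \<bar>D i x\<bar>) \<le> (\<Sum>i<n. M * \<bar>D i x\<bar>)"
      using x K by (intro sum_mono mult_right_mono dist_M) auto
    also have "\<dots> = M * F x"
      by (simp add: F_def sum_distrib_left)
    also have "\<dots> \<le> M * (C1 / (d - c) * (\<Sum>i<n. ?N (D i)))"
      using F M by (intro mult_left_mono) auto
    finally have lower_order: "(\<Sum>i<n. \<bar>x0 - x\<bar> ^ i * \<bar>D i x\<bar>) \<le> M * C1 / (d - c) * (\<Sum>i<n. ?N (D i))"
      by (simp add: mult.assoc)
    define h where "h = (\<lambda>t. \<bar>x0 - t\<bar> ^ (n - 1) * \<bar>D n t\<bar>)"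
    have hint: "integrable (lebesgue_on J) h"
      unfolding h_def by (rule int2[OF L])
    have hJ: "h integrable_on J"
      using hint by (auto simp: J_def intro!: set_lebesgue_integral_eq_integral(1) simp: set_integrable_def integrable_restrict_space)
    have hseg: "h integrable_on {min x x0..max x x0}"
      unfolding h_def by (intro integrable_continuous_interval continuous_intros cont)
    have "integral {min x x0..max x x0} h = integral {min x x0<..<max x x0} h"
      by (rule integral_open_interval_real)
    also have "\<dots> \<le> integral J h"
      using seg[OF x] hJ hseg
      by (intro integral_subset_le) (auto simp: J_def h_def integrable_on_Icc_iff_Ioo[symmetric])
    also have "\<dots> = (\<integral>t. h t \<partial>lebesgue_on J)"
      using hint by (intro lebesgue_integral_eq_integral[symmetric]) (auto simp: J_def)
    also have "\<dots> \<le> C2 * ?N (D n)"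
      unfolding h_def by (rule le2[OF L])
    finally have "\<bar>D 0 x0\<bar> \<le> M * C1 / (d - c) * (\<Sum>i<n. ?N (D i)) + C2 * ?N (D n)"
      using Taylor_bound[where D = D, OF der n, of x0 x] lower_order by (simp add: h_def)
    also have "\<dots> \<le> C * (\<Sum>i<n. ?N (D i)) + C * ?N (D n)"
      using M C1 C2 cd unfolding C_def by (intro add_mono mult_right_mono) (auto intro!: sum_nonneg)
    also have "\<dots> = C * (\<Sum>i\<le>n. ?N (D i))"
      by (simp add: lessThan_Suc_atMost[symmetric] distrib_left)
    finally show ?thesis .
  qed
  moreover have "0 \<le> C"
    using M C1 C2 cd by (simp add: C_def)
  ultimately show ?thesis
    using that by blast
qed

section \<open>Extension to the weighted Sobolev space\<close>

lemma test_function_has_real_derivative: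
  assumes "u \<in> test_functions"
  shows "((deriv ^^ n) u has_real_derivative (deriv ^^ Suc n) u x) (at x)"
  using assms
  by (auto simp: test_functions_def differentiable_on_def DERIV_deriv_iff_real_differentiable)

lemma higher_deriv_lincomb_test_function:
  assumes "f \<in> test_functions" "g \<in> test_functions"
  shows "(deriv ^^ n) (\<lambda>x. c * f x + d * g x) = (\<lambda>x. c * (deriv ^^ n) f x + d * (deriv ^^ n) g x)"
proof (induction n)
  case (Suc n)
  have "deriv (\<lambda>x. c * (deriv ^^ n) f x + d * (deriv ^^ n) g x) x =
      c * (deriv ^^ Suc n) f x + d * (deriv ^^ Suc n) g x" for x
    by (intro DERIV_imp_deriv derivative_intros DERIV_cmult test_function_has_real_derivative assms)
  then show ?case
    using Suc by auto
qed simp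

lemma test_functions_lincomb:
  assumes f: "f \<in> test_functions" and g: "g \<in> test_functions"
  shows "(\<lambda>x. c * f x + d * g x) \<in> test_functions"
proof -
  have "(deriv ^^ n) (\<lambda>x. c * f x + d * g x) differentiable_on UNIV" for n
    using f g unfolding higher_deriv_lincomb_test_function[OF f g]
    by (intro derivative_intros) (auto simp: test_functions_def)
  moreover have "bounded ({x. f x \<noteq> 0} \<union> {x. g x \<noteq> 0})"
    using f g by (auto simp: test_functions_def compact_closure)
  then have "bounded {x. c * f x + d * g x \<noteq> 0}"
    by (rule bounded_subset) auto
  ultimately show ?thesis
    by (auto simp: test_functions_def compact_closure)
qed

lemma continuous_in_Lp_weight_measure:
  assumes w: "weight a b w" and f: "continuous_on UNIV f" and p: "0 \<le> p"
  shows "f \<in> Lp (weight_measure a b w) p"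
proof -
  let ?W = "weight_measure a b w"
  have fm: "f \<in> borel_measurable (lebesgue_on {a<..<b})"
    using f by (intro continuous_imp_measurable_on_sets_lebesgue) (auto intro: continuous_on_subset)
  have wm: "(\<lambda>x. ennreal (w x)) \<in> borel_measurable (lebesgue_on {a<..<b})"
    using weight_borel_measurable[OF w] by measurable
  have sp: "space ?W = {a<..<b}"
    by (simp add: weight_measure_def)
  have "emeasure ?W (space ?W) = (\<integral>\<^sup>+x. ennreal (w x) * indicator {a<..<b} x \<partial>lebesgue_on {a<..<b})"
    unfolding sp unfolding weight_measure_def by (intro emeasure_density wm) (auto simp: sets_restrict_space_iff)
  also have "\<dots> \<le> (\<integral>\<^sup>+x. ennreal (norm (w x)) \<partial>lebesgue_on {a<..<b})"
    by (intro nn_integral_mono) (auto simp: ennreal_leI split: split_indicator)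
  also have "\<dots> < \<infinity>"
    using w by (simp add: weight_def integrable_iff_bounded)
  finally have fin: "finite_measure ?W"
    by (intro finite_measureI) auto
  have "compact (f ` {a..b})"
    using f by (intro compact_continuous_image) (auto intro: continuous_on_subset)
  then obtain B where B: "\<And>x. x \<in> {a..b} \<Longrightarrow> \<bar>f x\<bar> \<le> B"
    using compact_imp_bounded bounded_iff by (metis image_eqI real_norm_def)
  have "integrable ?W (\<lambda>x. \<bar>f x\<bar> powr p)"
  proof (rule Bochner_Integration.integrable_bound)
    show "integrable ?W (\<lambda>x. B powr p)"
      using fin by (intro finite_measure.integrable_const)
    have "f \<in> borel_measurable ?W"
      using fm by simp
    then show "(\<lambda>x. \<bar>f x\<bar> powr p) \<in> borel_measurable ?W"
      by measurable
    show "AE x in ?W. norm (\<bar>f x\<bar> powr p) \<le> norm (B powr p)"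
      by (intro AE_I2) (use B p sp in \<open>auto intro!: powr_mono2\<close>)
  qed
  then show ?thesis
    using fm by (simp add: Lp_def)
qed

lemma higher_deriv_test_function_in_Lp:
  assumes "weight a b w" "0 \<le> p" "u \<in> test_functions"
  shows "(deriv ^^ n) u \<in> Lp (weight_measure a b w) p"
  using assms
  by (intro continuous_in_Lp_weight_measure)
     (auto intro!: DERIV_continuous_on[OF has_field_derivative_at_within[OF test_function_has_real_derivative]])

text \<open>
  The sequence \<open>v\<close> of limits includes order zero, so that functions and their derivatives are treated
  uniformly in \<open>k\<close>.
\<close>
definition approximates ::
  "real measure \<Rightarrow> real \<Rightarrow> nat \<Rightarrow> (nat \<Rightarrow> real \<Rightarrow> real) \<Rightarrow> (nat \<Rightarrow> real \<Rightarrow> real) \<Rightarrow> bool" where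
  "approximates W p m U v \<longleftrightarrow>
     (\<forall>h. U h \<in> test_functions) \<and> (\<forall>k\<le>m. Lp_tendsto W p (\<lambda>h. (deriv ^^ k) (U h)) (v k))"

lemma approximates_lincomb:
  assumes p: "1 \<le> p" and U: "approximates W p m U u" and V: "approximates W p m V v"
  shows "approximates W p m (\<lambda>h x. c * U h x + d * V h x) (\<lambda>k x. c * u k x + d * v k x)"
  using assms unfolding approximates_def
  by (simp add: test_functions_lincomb higher_deriv_lincomb_test_function Lp_tendsto_lincomb)

lemma sobolev_derivs_iff_approximates:
  "sobolev_derivs a b p w m u v \<longleftrightarrow>
     (\<exists>U. approximates (weight_measure a b w) p m U (v(0 := u)))"
proof -
  have split: "(\<forall>k\<le>m. P k) \<longleftrightarrow> P 0 \<and> (\<forall>k\<in>{1..m}. P k)" for P :: "nat \<Rightarrow> bool"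
    by (metis atLeastAtMost_iff le0 less_one not_less)
  show ?thesis
    unfolding sobolev_derivs_def approximates_def split by auto
qed

lemma approximates_sobolev_D:
  assumes "u \<in> sobolev a b p w m"
  shows "\<exists>U. approximates (weight_measure a b w) p m U (\<lambda>k. sobolev_D a b p w m k u)"
proof -
  have "\<exists>v. sobolev_derivs a b p w m u v"
    using assms by (simp add: sobolev_def)
  then have "sobolev_derivs a b p w m u (SOME v. sobolev_derivs a b p w m u v)"
    by (rule someI_ex)
  moreover have "(\<lambda>k. sobolev_D a b p w m k u) = (SOME v. sobolev_derivs a b p w m u v)(0 := u)"
    by (auto simp: sobolev_D_def)
  ultimately show ?thesis
    by (simp add: sobolev_derivs_iff_approximates)
qed

text \<open>
  Induction on the order: once \<open>v k\<close> vanishes, \<open>v (Suc k)\<close> is a limit of derivatives of a null sequence.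
\<close>
lemma approximates_zero_unique:
  assumes stable: "stable_weight a b p w" and p: "1 \<le> p"
    and U: "approximates (weight_measure a b w) p m U v"
    and v0: "AE x in weight_measure a b w. v 0 x = 0"
    and "k \<le> m"
  shows "AE x in weight_measure a b w. v k x = 0"
  using \<open>k \<le> m\<close>
proof (induction k)
  case (Suc k)
  let ?W = "weight_measure a b w"
  have zero: "(\<lambda>_. 0) \<in> Lp ?W p"
    by (simp add: Lp_def)
  have "Lp_tendsto ?W p (\<lambda>h. (deriv ^^ k) (U h)) (v k)"
    using U Suc by (simp add: approximates_def)
  then have "Lp_tendsto ?W p (\<lambda>h. (deriv ^^ k) (U h)) (\<lambda>_. 0)"
    by (rule Lp_tendsto_cong_AE) (use Suc zero in auto)
  moreover have "Lp_tendsto ?W p (\<lambda>h. (deriv ^^ Suc k) (U h)) (v (Suc k))"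
    using U Suc.prems unfolding approximates_def by blast
  moreover have "\<And>h x. ((deriv ^^ k) (U h) has_real_derivative (deriv ^^ Suc k) (U h) x) (at x)"
    using U by (intro test_function_has_real_derivative) (simp add: approximates_def)
  ultimately show ?case
    by (intro derivative_limit_zero[OF stable p])
qed (use v0 in simp)

lemma Lp_norm_le_sobolev_norm:
  assumes "1 \<le> p" "k \<le> m"
  shows "Lp_norm (weight_measure a b w) p (sobolev_D a b p w m k u) \<le> sobolev_norm a b p w m u"
proof -
  let ?N = "\<lambda>k. Lp_norm (weight_measure a b w) p (sobolev_D a b p w m k u)"
  have "?N k = (?N k powr p) powr (1 / p)"
    using assms by (simp add: powr_powr)
  also have "\<dots> \<le> (\<Sum>k\<le>m. ?N k powr p) powr (1 / p)"
    using assms by (intro powr_mono2 member_le_sum) auto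
  finally show ?thesis
    by (simp add: sobolev_norm_def)
qed

text \<open>
  Extension by continuity. The Sobolev space consists of functions with a chosen representative of
  their derivatives, and linear combinations of the choices need not be the choices for the linear
  combination. Hence the value at \<open>u\<close> is defined as the common limit along all approximating sequences of \<open>u\<close>,
  which is linear because sequences can be combined; that the limits agree follows from the
  uniqueness of the derivatives.
\<close>
lemma bounded_functional_extends:
  assumes stable: "stable_weight a b p w" and p: "1 \<le> p" and C: "0 \<le> C"
    and lin: "\<And>f g c d. f \<in> test_functions \<Longrightarrow> g \<in> test_functions \<Longrightarrow>
                T (\<lambda>x. c * f x + d * g x) = c * T f + d * T g"
    and bound: "\<And>f. f \<in> test_functions \<Longrightarrow>
                \<bar>T f\<bar> \<le> C * (\<Sum>k\<le>m. Lp_norm (weight_measure a b w) p ((deriv ^^ k) f))"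
  shows "has_continuous_extension a b p w m T"
proof -
  let ?W = "weight_measure a b w"
  let ?N = "Lp_norm ?W p"
  let ?A = "approximates ?W p m"
  let ?S = "sobolev a b p w m"
  let ?D = "\<lambda>u k. sobolev_D a b p w m k u"
  have w: "weight a b w"
    using stable by (simp add: stable_weight_def)
  have AL: "(deriv ^^ k) (U h) \<in> Lp ?W p" "v k \<in> Lp ?W p" if "?A U v" "k \<le> m" for U v k h
    using that unfolding approximates_def Lp_tendsto_def by blast+
  have Atest: "U h \<in> test_functions" if "?A U v" for U v h
    using that by (simp add: approximates_def)
  define err where "err = (\<lambda>(U :: nat \<Rightarrow> real \<Rightarrow> real) v h. \<Sum>k\<le>m. ?N (\<lambda>x. (deriv ^^ k) (U h) x - v k x))"
  have err0: "err U v \<longlonglongrightarrow> 0" if "?A U v" for U v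
  proof -
    have "err U v \<longlonglongrightarrow> (\<Sum>k\<le>m. 0)"
      unfolding err_def using that
      by (intro tendsto_sum) (auto simp: approximates_def Lp_tendsto_def)
    then show ?thesis by simp
  qed
  have bound_limit: "\<bar>T (U h)\<bar> \<le> C * (4 * (err U v h + (\<Sum>k\<le>m. ?N (v k))))" if A: "?A U v" for U v h
  proof -
    have "?N ((deriv ^^ k) (U h)) \<le> 4 * (?N (\<lambda>x. (deriv ^^ k) (U h) x - v k x) + ?N (v k))" if "k \<le> m" for k
      using Lp_norm_add_le[OF p Lp_diff[OF _ AL(1)[OF A that, of h] AL(2)[OF A that]] AL(2)[OF A that]] p
      by simp
    then have "(\<Sum>k\<le>m. ?N ((deriv ^^ k) (U h))) \<le>
        (\<Sum>k\<le>m. 4 * (?N (\<lambda>x. (deriv ^^ k) (U h) x - v k x) + ?N (v k)))"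
      by (intro sum_mono) auto
    also have "\<dots> = 4 * (err U v h + (\<Sum>k\<le>m. ?N (v k)))"
      by (simp add: err_def sum_distrib_left[symmetric] sum.distrib)
    finally show ?thesis
      using bound[OF Atest[OF A], of h] mult_left_mono[OF _ C] by (meson order_trans)
  qed
  have conv: "convergent (\<lambda>h. T (U h))" if A: "?A U v" for U v
  proof -
    have cauchy: "\<bar>T (U h) - T (U j)\<bar> \<le> 4 * C * err U v h + 4 * C * err U v j" for h j
    proof -
      have "?N ((deriv ^^ k) (\<lambda>x. 1 * U h x + (- 1) * U j x)) \<le>
          4 * (?N (\<lambda>x. (deriv ^^ k) (U h) x - v k x) + ?N (\<lambda>x. (deriv ^^ k) (U j) x - v k x))"
        if k: "k \<le> m" for k
      proof -
        have eq: "(deriv ^^ k) (\<lambda>x. 1 * U h x + (- 1) * U j x) =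
            (\<lambda>x. 1 * ((deriv ^^ k) (U h) x - v k x) + (- 1) * ((deriv ^^ k) (U j) x - v k x))"
          unfolding higher_deriv_lincomb_test_function[OF Atest[OF A] Atest[OF A]] by auto
        show ?thesis
          unfolding eq
          using Lp_norm_lincomb_le[OF p Lp_diff[OF _ AL(1)[OF A k, of h] AL(2)[OF A k]]
              Lp_diff[OF _ AL(1)[OF A k, of j] AL(2)[OF A k]], of 1 "- 1"] p
          by simp
      qed
      then have "(\<Sum>k\<le>m. ?N ((deriv ^^ k) (\<lambda>x. 1 * U h x + (- 1) * U j x))) \<le>
          (\<Sum>k\<le>m. 4 * (?N (\<lambda>x. (deriv ^^ k) (U h) x - v k x) + ?N (\<lambda>x. (deriv ^^ k) (U j) x - v k x)))"
        by (intro sum_mono) auto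
      also have "\<dots> = 4 * (err U v h + err U v j)"
        by (simp add: err_def sum_distrib_left[symmetric] sum.distrib)
      finally have "\<bar>T (\<lambda>x. 1 * U h x + (- 1) * U j x)\<bar> \<le> C * (4 * (err U v h + err U v j))"
        using bound[OF test_functions_lincomb[OF Atest[OF A] Atest[OF A]], of 1 h "- 1" j]
          mult_left_mono[OF _ C] by (meson order_trans)
      then show ?thesis
        by (subst (asm) lin[OF Atest[OF A] Atest[OF A]]) (simp add: algebra_simps)
    qed
    have "(\<lambda>h. 4 * C * err U v h) \<longlonglongrightarrow> 4 * C * 0"
      by (intro tendsto_intros err0[OF A])
    then have lim: "(\<lambda>h. 4 * C * err U v h) \<longlonglongrightarrow> 0"
      by simp
    have "Cauchy (\<lambda>h. T (U h))"
    proof (rule metric_CauchyI)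
      fix e :: real assume "0 < e"
      then have "eventually (\<lambda>h. 4 * C * err U v h < e / 2) sequentially"
        by (intro order_tendstoD(2)[OF lim]) simp
      then obtain n0 where n0: "\<And>h. n0 \<le> h \<Longrightarrow> 4 * C * err U v h < e / 2"
        by (auto simp: eventually_sequentially)
      have "dist (T (U h)) (T (U j)) < e" if "n0 \<le> h" "n0 \<le> j" for h j
        using cauchy[of h j] n0[OF that(1)] n0[OF that(2)] by (simp add: dist_real_def)
      then show "\<exists>M. \<forall>h\<ge>M. \<forall>j\<ge>M. dist (T (U h)) (T (U j)) < e"
        by blast
    qed
    then show ?thesis
      by (simp add: Cauchy_convergent_iff)
  qed
  have limit_bound: "\<bar>l\<bar> \<le> 4 * C * (\<Sum>k\<le>m. ?N (v k))" if A: "?A U v" and l: "(\<lambda>h. T (U h)) \<longlonglongrightarrow> l" for U v l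
  proof (rule LIMSEQ_le[OF tendsto_rabs[OF l]])
    have "(\<lambda>h. C * (4 * (err U v h + (\<Sum>k\<le>m. ?N (v k))))) \<longlonglongrightarrow> C * (4 * (0 + (\<Sum>k\<le>m. ?N (v k))))"
      by (intro tendsto_intros err0[OF A])
    then show "(\<lambda>h. C * (4 * (err U v h + (\<Sum>k\<le>m. ?N (v k))))) \<longlonglongrightarrow> 4 * C * (\<Sum>k\<le>m. ?N (v k))"
      by (simp add: mult_ac)
  qed (use bound_limit[OF A] in auto)
  have limit_unique: "l = l'"
    if A: "?A U u" "?A V v" and eq: "AE x in ?W. u 0 x = v 0 x"
      and l: "(\<lambda>h. T (U h)) \<longlonglongrightarrow> l" "(\<lambda>h. T (V h)) \<longlonglongrightarrow> l'" for U u V v l l'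
  proof -
    let ?d = "\<lambda>k x. 1 * u k x + (- 1) * v k x"
    have Ad: "?A (\<lambda>h x. 1 * U h x + (- 1) * V h x) ?d"
      by (rule approximates_lincomb[OF p A])
    have "(\<lambda>h. T (\<lambda>x. 1 * U h x + (- 1) * V h x)) \<longlonglongrightarrow> 1 * l + (- 1) * l'"
      unfolding lin[OF Atest[OF A(1)] Atest[OF A(2)]] by (intro tendsto_intros l)
    then have "\<bar>1 * l + (- 1) * l'\<bar> \<le> 4 * C * (\<Sum>k\<le>m. ?N (?d k))"
      by (rule limit_bound[OF Ad])
    moreover have "?N (?d k) = 0" if k: "k \<le> m" for k
    proof -
      have "AE x in ?W. ?d k x = 0"
        by (rule approximates_zero_unique[OF stable p Ad _ k]) (use eq in auto)
      then have "?N (?d k) = ?N (\<lambda>_. 0)"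
        using AL(2)[OF Ad k, of ] by (intro Lp_norm_cong_AE) (auto simp: Lp_def)
      then show ?thesis
        by (simp add: Lp_norm_def)
    qed
    ultimately show ?thesis by simp
  qed
  define E where "E u = (THE l. \<exists>U v. ?A U v \<and> (AE x in ?W. v 0 x = u x) \<and> (\<lambda>h. T (U h)) \<longlonglongrightarrow> l)" for u
  have E: "(\<lambda>h. T (U h)) \<longlonglongrightarrow> E u" if A: "?A U v" and eq: "AE x in ?W. v 0 x = u x" for U v u
  proof -
    obtain l where l: "(\<lambda>h. T (U h)) \<longlonglongrightarrow> l"
      using conv[OF A] by (auto simp: convergent_def)
    have "E u = l"
      unfolding E_def
    proof (rule the_equality)
      fix l' assume "\<exists>U v. ?A U v \<and> (AE x in ?W. v 0 x = u x) \<and> (\<lambda>h. T (U h)) \<longlonglongrightarrow> l'"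
      then obtain U' v' where A': "?A U' v'" and eq': "AE x in ?W. v' 0 x = u x"
        and l': "(\<lambda>h. T (U' h)) \<longlonglongrightarrow> l'"
        by blast
      have "AE x in ?W. v' 0 x = v 0 x"
        using eq eq' by eventually_elim simp
      then show "l' = l"
        by (rule limit_unique[OF A' A _ l' l])
    qed (use A eq l in blast)
    then show ?thesis
      using l by simp
  qed
  have D0: "?D u 0 = u" for u
    by (simp add: sobolev_D_def)
  have lincomb: "(\<lambda>x. c * u x + d * v x) \<in> ?S \<and> E (\<lambda>x. c * u x + d * v x) = c * E u + d * E v"
    if u: "u \<in> ?S" and v: "v \<in> ?S" for u v c d
  proof
    obtain U V where U: "?A U (?D u)" and V: "?A V (?D v)"
      using approximates_sobolev_D u v by blast
    let ?U = "\<lambda>h x. c * U h x + d * V h x" and ?v = "\<lambda>k x. c * ?D u k x + d * ?D v k x"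
    let ?f = "\<lambda>x. c * u x + d * v x"
    have A: "?A ?U ?v"
      by (rule approximates_lincomb[OF p U V])
    have v0: "?v 0 = ?f"
      by (simp add: D0)
    have "?v(0 := ?f) = ?v"
      using v0 by (auto simp: fun_eq_iff)
    then have "sobolev_derivs a b p w m ?f ?v"
      using A unfolding sobolev_derivs_iff_approximates by metis
    moreover have "?f \<in> Lp ?W p"
      using AL(2)[OF A, of 0] v0 by simp
    ultimately show "?f \<in> ?S"
      by (auto simp: sobolev_def)
    have "(\<lambda>h. T (?U h)) \<longlonglongrightarrow> E ?f"
      by (rule E[OF A]) (simp add: D0)
    moreover have "(\<lambda>h. T (?U h)) \<longlonglongrightarrow> c * E u + d * E v"
      unfolding lin[OF Atest[OF U] Atest[OF V]]
      by (intro tendsto_intros E[OF U] E[OF V]) (simp_all add: D0)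
    ultimately show "E ?f = c * E u + d * E v"
      by (rule LIMSEQ_unique)
  qed
  have E_bound: "\<bar>E u\<bar> \<le> 4 * C * (real (Suc m) * sobolev_norm a b p w m u)" if u: "u \<in> ?S" for u
  proof -
    obtain U where U: "?A U (?D u)"
      using approximates_sobolev_D u by blast
    have "(\<lambda>h. T (U h)) \<longlonglongrightarrow> E u"
      by (rule E[OF U]) (simp add: D0)
    then have "\<bar>E u\<bar> \<le> 4 * C * (\<Sum>k\<le>m. ?N (?D u k))"
      by (rule limit_bound[OF U])
    also have "\<dots> \<le> 4 * C * (\<Sum>k\<le>m. sobolev_norm a b p w m u)"
      using C p by (intro mult_left_mono sum_mono Lp_norm_le_sobolev_norm) auto
    finally show ?thesis by simp
  qed
  show ?thesis
    unfolding has_continuous_extension_def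
  proof (intro exI[of _ E] conjI ballI allI impI)
    fix u v assume u: "u \<in> ?S" and v: "v \<in> ?S" and eq: "AE x in ?W. u x = v x"
    obtain U where U: "?A U (?D u)"
      using approximates_sobolev_D u by blast
    have "(\<lambda>h. T (U h)) \<longlonglongrightarrow> E u" "(\<lambda>h. T (U h)) \<longlonglongrightarrow> E v"
      using eq by (intro E[OF U]; simp add: D0)+
    then show "E u = E v"
      by (rule LIMSEQ_unique)
  next
    fix u v c d assume "u \<in> ?S" "v \<in> ?S"
    then show "E (\<lambda>x. c * u x + d * v x) = c * E u + d * E v"
      using lincomb by blast
  next
    fix u \<epsilon> assume u: "u \<in> ?S" and \<epsilon>: "(0::real) < \<epsilon>"
    define K where "K = 4 * C * real (Suc m) + 1"
    have K: "0 < K"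
      using C by (simp add: K_def add_nonneg_pos)
    show "\<exists>\<delta>>0. \<forall>v\<in>?S. sobolev_norm a b p w m (\<lambda>x. v x - u x) < \<delta> \<longrightarrow> \<bar>E v - E u\<bar> < \<epsilon>"
    proof (intro exI[of _ "\<epsilon> / K"] conjI ballI impI)
      fix v assume v: "v \<in> ?S" and small: "sobolev_norm a b p w m (\<lambda>x. v x - u x) < \<epsilon> / K"
      have diff: "(\<lambda>x. v x - u x) \<in> ?S" "E (\<lambda>x. v x - u x) = E v - E u"
        using lincomb[OF v u, of 1 "- 1"] by auto
      have "\<bar>E v - E u\<bar> \<le> 4 * C * real (Suc m) * sobolev_norm a b p w m (\<lambda>x. v x - u x)"
        using E_bound[OF diff(1)] diff(2) by (simp add: mult.assoc)
      also have "\<dots> \<le> K * sobolev_norm a b p w m (\<lambda>x. v x - u x)"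
        by (intro mult_right_mono) (auto simp: K_def sobolev_norm_def)
      also have "\<dots> < \<epsilon>"
        using small K by (simp add: field_simps)
      finally show "\<bar>E v - E u\<bar> < \<epsilon>" .
    qed (use \<epsilon> K in simp)
  next
    fix f assume f: "f \<in> test_functions"
    have "?A (\<lambda>_. f) (\<lambda>k. (deriv ^^ k) f)"
      using f p unfolding approximates_def
      by (auto intro!: Lp_tendsto_const higher_deriv_test_function_in_Lp[OF w])
    then have "(\<lambda>_. T f) \<longlonglongrightarrow> E f"
      by (rule E) simp
    then show "E f = T f"
      by (simp add: LIMSEQ_const_iff)
  qed
qed

lemma higher_derivative_trace_extends:
  assumes stable: "stable_weight a b p w" and p: "1 \<le> p" and ab: "a < b"
    and x0: "x0 \<in> {a..b}" "x0 \<notin> crit_set a b p w \<alpha>"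
    and k: "k < m" and \<alpha>: "0 \<le> \<alpha>" "\<alpha> \<le> real (m - k) - 1"
  shows "has_continuous_extension a b p w m (\<lambda>u. (deriv ^^ k) u x0)"
proof -
  let ?N = "Lp_norm (weight_measure a b w) p"
  have w: "weight a b w"
    using stable by (simp add: stable_weight_def)
  obtain C where C: "0 \<le> C"
    and bound: "\<And>D. (\<And>i t. (D i has_real_derivative D (Suc i) t) (at t)) \<Longrightarrow>
       (\<And>i. D i \<in> Lp (weight_measure a b w) p) \<Longrightarrow>
       \<bar>D 0 x0\<bar> \<le> C * (\<Sum>i\<le>m - k. ?N (D i))"
    using trace_bound[OF w p ab x0 _ \<alpha>] k by (metis zero_less_diff)
  show ?thesis
  proof (rule bounded_functional_extends[OF stable p C])
    fix f assume f: "f \<in> test_functions"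
    have "\<bar>(deriv ^^ k) f x0\<bar> \<le> C * (\<Sum>i\<le>m - k. ?N ((deriv ^^ (k + i)) f))"
      using bound[of "\<lambda>i. (deriv ^^ (k + i)) f"] test_function_has_real_derivative[OF f, of "k + _"]
        higher_deriv_test_function_in_Lp[OF w _ f] p
      by (simp only: add_Suc_right add_0_right)
    also have "(\<Sum>i\<le>m - k. ?N ((deriv ^^ (k + i)) f)) = (\<Sum>j\<in>{k..m}. ?N ((deriv ^^ j) f))"
      by (rule sum.reindex_bij_witness[of _ "\<lambda>j. j - k" "\<lambda>i. k + i"]) (use k in auto)
    also have "C * \<dots> \<le> C * (\<Sum>j\<le>m. ?N ((deriv ^^ j) f))"
      using C by (intro mult_left_mono sum_mono2) auto
    finally show "\<bar>(deriv ^^ k) f x0\<bar> \<le> C * (\<Sum>j\<le>m. ?N ((deriv ^^ j) f))" .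
  qed (simp add: higher_deriv_lincomb_test_function)
qed

theorem proposition5p1:
  fixes a b p :: real and w :: "real \<Rightarrow> real" and m kbar :: nat
  assumes "a < b"
    and "1 \<le> p"
    and "stable_weight a b p w"
    and "1 \<le> m"
    and "kbar \<in> {0..m - 1}"
  shows "(a \<notin> crit_set a b p w (real (m - kbar) - 1) \<longrightarrow>
            (\<forall>k \<in> {0..kbar}. has_continuous_extension a b p w m (\<lambda>u. (deriv ^^ k) u a))) \<and>
         (b \<notin> crit_set a b p w (real (m - kbar) - 1) \<longrightarrow>
            (\<forall>k \<in> {0..kbar}. has_continuous_extension a b p w m (\<lambda>u. (deriv ^^ k) u b)))"
proof -
  have "has_continuous_extension a b p w m (\<lambda>u. (deriv ^^ k) u x0)"
    if "x0 \<in> {a..b}" "x0 \<notin> crit_set a b p w (real (m - kbar) - 1)" "k \<in> {0..kbar}" for x0 k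
    using that assms by (intro higher_derivative_trace_extends[of a b p w x0 "real (m - kbar) - 1" k m]) auto
  then show ?thesis
    using \<open>a < b\<close> by simp
qed

end
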